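(* There exist absolute constants $\alpha>1$ and $c_1>0$ with the following property: for every $n\geq 1$ and every convex body $K$ in $\mathbb{R}^n$ whose center of mass is at the origin, if $N=\lceil \alpha n\rceil$ and if $x_1,\ldots,x_N$ are independent random points uniformly distributed in $K$, then with probability greater than $1-e^{-n}$ we have $$K\subseteq c_1 n\,\mathrm{conv}(\{x_1,\ldots,x_N\}).$$
   Context: A convex body in $\mathbb{R}^n$ is a compact convex subset of $\mathbb{R}^n$ with non-empty interior. The center of mass of $K$ is $\frac{1}{|K|}\int_K x\,dx$, where $|\cdot|$ denotes $n$-dimensional volume. "Uniformly distributed in $K$" means distributed according to normalized Lebesgue measure on $K$. "Absolute constant" means a constant that does not depend on $n$, $K$, or any other parameter. *)

theory Defs
  imports "HOL-Probability.Probability"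
begin

text \<open>
  The constants of the theorem are chosen before the dimension \<open>n\<close>, so \<open>n\<close> cannot be a type.
  A point of \<open>\<real>\<^sup>n\<close> is a function in \<open>{..<n} \<rightarrow>\<^sub>E UNIV\<close>; this set is both the underlying set of
  the product topology and the space of the product measure below.
\<close>

type_synonym point = "nat \<Rightarrow> real"

definition Rn_topology :: "nat \<Rightarrow> point topology" where
  "Rn_topology n = product_topology (\<lambda>_. euclideanreal) {..<n}"

definition Rn_lborel :: "nat \<Rightarrow> point measure" where
  "Rn_lborel n = (\<Pi>\<^sub>M i\<in>{..<n}. lborel)"

definition Rn_origin :: "nat \<Rightarrow> point" where
  "Rn_origin n = (\<lambda>i\<in>{..<n}. 0)"

definition Rn_convex :: "nat \<Rightarrow> point set \<Rightarrow> bool" where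
  "Rn_convex n S \<longleftrightarrow> S \<subseteq> {..<n} \<rightarrow>\<^sub>E UNIV \<and>
     (\<forall>x\<in>S. \<forall>y\<in>S. \<forall>u\<ge>0. \<forall>v\<ge>0. u + v = 1 \<longrightarrow> (\<lambda>i\<in>{..<n}. u * x i + v * y i) \<in> S)"

definition Rn_scale :: "nat \<Rightarrow> real \<Rightarrow> point set \<Rightarrow> point set" where
  "Rn_scale n c S = (\<lambda>x. \<lambda>i\<in>{..<n}. c * x i) ` S"

definition convex_body :: "nat \<Rightarrow> point set \<Rightarrow> bool" where
  "convex_body n K \<longleftrightarrow>
     Rn_convex n K \<and> compactin (Rn_topology n) K \<and> Rn_topology n interior_of K \<noteq> {}"

definition center_of_mass :: "nat \<Rightarrow> point set \<Rightarrow> point" where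
  "center_of_mass n K =
     (\<lambda>i\<in>{..<n}. (1 / measure (Rn_lborel n) K) * (LINT x:K|Rn_lborel n. x i))"

definition uniform_on :: "nat \<Rightarrow> point set \<Rightarrow> point measure" where
  "uniform_on n K = uniform_measure (Rn_lborel n) K"

definition iid_uniform :: "nat \<Rightarrow> point set \<Rightarrow> nat \<Rightarrow> (nat \<Rightarrow> point) measure" where
  "iid_uniform n K N = (\<Pi>\<^sub>M j\<in>{..<N}. uniform_on n K)"

text \<open>
  \<open>iid_uniform n K N\<close> is the joint law of any \<open>N\<close> independent points uniformly distributed in \<open>K\<close>,
  on whatever probability space they live. Stating the theorem for this law avoids a type variable
  for the sample space, on which the constants could otherwise depend.
\<close>

lemma (in prob_space) distr_indep_uniform_eq_iid_uniform:
  fixes X :: "nat \<Rightarrow> 'a \<Rightarrow> point"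
  assumes "N > 0"
    and "indep_vars (\<lambda>_. Rn_lborel n) X {..<N}"
    and "\<And>j. j < N \<Longrightarrow> distr M (Rn_lborel n) (X j) = uniform_on n K"
  shows "distr M (\<Pi>\<^sub>M j\<in>{..<N}. Rn_lborel n) (\<lambda>\<omega>. \<lambda>j\<in>{..<N}. X j \<omega>) = iid_uniform n K N"
proof -
  have rv: "random_variable (Rn_lborel n) (X j)" if "j \<in> {..<N}" for j
    using assms(2) that by (auto simp: indep_vars_def)
  have "distr M (\<Pi>\<^sub>M j\<in>{..<N}. Rn_lborel n) (\<lambda>\<omega>. \<lambda>j\<in>{..<N}. X j \<omega>) =
      (\<Pi>\<^sub>M j\<in>{..<N}. distr M (Rn_lborel n) (X j))"
    using indep_vars_iff_distr_eq_PiM'[of "{..<N}" X "\<lambda>_. Rn_lborel n"] rv assms(1,2) by auto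
  also have "\<dots> = iid_uniform n K N"
    unfolding iid_uniform_def by (intro PiM_cong) (auto simp: assms(3))
  finally show ?thesis .
qed

end

theory Submission
  imports Defs
begin

text \<open>
  If \<open>K\<close> is not contained in \<open>2n conv{x\<^sub>1, \<dots>, x\<^sub>N}\<close>, then a hyperplane separates: for some direction
  \<open>\<theta>\<close>, which may be taken rational, all \<open>x\<^sub>i\<close> miss the halfspace \<open>{x. \<langle>x, \<theta>\<rangle> \<ge> h\<^sub>K(\<theta>) / (2n)}\<close>.
  Each such halfspace carries at least 1/12 of the volume of \<open>K\<close>. Indeed, by the Prekopa-Leindler
  inequality the tail \<open>s \<mapsto> P(\<langle>x, \<theta>\<rangle> \<ge> s)\<close> is log-concave, so it decays geometrically once it is
  small at 0, and the centroid condition then forces \<open>P(\<langle>x, \<theta>\<rangle> \<ge> 0) \<ge> 1/6\<close>; contracting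
  by \<open>1 - 1/(2n)\<close> towards a point of \<open>K\<close> maximal in direction \<open>\<theta>\<close> costs at most a factor of 2.
  Halfspaces of \<open>\<real>\<^sup>n\<close> shatter at most \<open>n + 1\<close> points, so by the double sampling argument of Vapnik
  and Chervonenkis a sample of \<open>960n\<close> points meets all these halfspaces simultaneously, except with
  probability less than \<open>exp(-n)\<close>.
\<close>

section \<open>The Sauer-Shelah bound for halfspaces\<close>

text \<open>For one fixed halfspace the sample fails with probability at most (11/12)^N, which is
  ample. The obstacle is that there are infinitely many directions and the bad one depends on the
  sample. Double sampling leaves only finitely many traces to sum over, and their number is
  exponential in \<open>n\<close> at a rate that a constant multiple N of \<open>n\<close> can beat,
  so no logarithmic factor enters N. Rational directions make the family of halfspaces countable and
  hence the failure event measurable. That event has to be the exact complement of the one in the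
  theorem, since \<open>measure\<close> is 0 on nonmeasurable sets. Log-concavity is used only at
  midpoints, so Prekopa-Leindler is proved only for midpoints, in a squared form that avoids roots.
  The bound 1/6 is weaker than Gruenbaum's sharp 1/e, but a geometric series suffices for it. Origin
  of the constants: a second sample is expected to hit a halfspace at least N/12 times; half of this
  is the threshold \<open>k\<close> = 40n, which makes N = 960n.\<close>

definition shatters :: "'a set set \<Rightarrow> 'a set \<Rightarrow> bool" where
  "shatters F S \<longleftrightarrow> (\<forall>T\<subseteq>S. \<exists>A\<in>F. A \<inter> S = T)"

text \<open>Pajor's form of the Sauer-Shelah lemma: counting shattered sets instead of binomial
  coefficients makes the induction additive. After deletion of \<open>x\<close>, \<open>F0\<close>
  holds all traces and \<open>F1\<close> those that come from two members of \<open>F\<close>. Sets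
  shattered by \<open>F0\<close> are shattered by \<open>F\<close>; sets shattered by
  \<open>F1\<close> stay shattered by \<open>F\<close> when \<open>x\<close> is added. The two kinds
  differ in whether they contain \<open>x\<close>.\<close>

lemma card_le_card_shattered:
  assumes "finite X" "F \<subseteq> Pow X"
  shows "card F \<le> card {S. S \<subseteq> X \<and> shatters F S}"
  using assms
proof (induction X arbitrary: F rule: finite_induct)
  case empty
  show ?case
  proof (cases "F = {}")
    case False
    then have F: "F = {{}}" using empty by auto
    then have eq: "{S. S \<subseteq> {} \<and> shatters F S} = {{}}"
      by (auto simp: shatters_def)
    show ?thesis by (subst eq) (simp add: F)
  qed simp
next
  case (insert x X)
  define F0 where "F0 = (\<lambda>A. A - {x}) ` F"
  define F1 where "F1 = {A. x \<notin> A \<and> A \<in> F \<and> insert x A \<in> F}"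
  \<comment> \<open>\<open>G\<close> keeps one member of each fibre of the deletion map, the one
    without \<open>x\<close> if both occur. So \<open>G\<close> corresponds to \<open>F0\<close>,
    and the remaining members to \<open>F1\<close>.\<close>
  define G where "G = {A \<in> F. x \<notin> A \<or> A - {x} \<notin> F}"
  have fin: "finite F" using insert.prems insert.hyps(1) by (meson finite_Pow_iff finite_insert finite_subset)
  have sub: "F0 \<subseteq> Pow X" "F1 \<subseteq> Pow X" using insert.prems by (auto simp: F0_def F1_def)
  have G: "F - G = insert x ` F1"
  proof (intro equalityI subsetI)
    fix A assume "A \<in> F - G"
    then have "A = insert x (A - {x})" "A - {x} \<in> F1"
      by (auto simp: G_def F1_def insert_absorb)
    then show "A \<in> insert x ` F1" by blast
  qed (auto simp: G_def F1_def)
  have "inj_on (\<lambda>A. A - {x}) G"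
  proof (rule inj_onI)
    fix A B assume AB: "A \<in> G" "B \<in> G" "A - {x} = B - {x}"
    have "x \<in> A \<longleftrightarrow> x \<in> B"
    proof (rule ccontr)
      assume "\<not> ?thesis"
      then consider "x \<in> A" "x \<notin> B" | "x \<in> B" "x \<notin> A" by blast
      then show False
      proof cases
        case 1
        then have "A - {x} = B" using AB by simp
        then show False using 1 AB by (simp add: G_def)
      next
        case 2
        then have "B - {x} = A" using AB by simp
        then show False using 2 AB by (simp add: G_def)
      qed
    qed
    then show "A = B" using AB(3) by (cases "x \<in> A") (metis insert_Diff, simp)
  qed
  moreover have "(\<lambda>A. A - {x}) ` G = F0"
  proof
    show "F0 \<subseteq> (\<lambda>A. A - {x}) ` G"
    proof
      fix B assume "B \<in> F0"
      then obtain A where A: "A \<in> F" "B = A - {x}" by (auto simp: F0_def)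
      show "B \<in> (\<lambda>A. A - {x}) ` G"
      proof (cases "A \<in> G")
        case False
        then have "B \<in> G" "B = B - {x}" using A by (auto simp: G_def)
        then show ?thesis by blast
      qed (use A in auto)
    qed
  qed (auto simp: F0_def G_def)
  ultimately have "card G = card F0" by (metis card_image)
  moreover have "inj_on (insert x) F1" by (intro inj_onI) (auto simp: F1_def)
  then have "card (F - G) = card F1" using G by (simp add: card_image)
  moreover have "card F = card G + card (F - G)"
    using fin by (subst card_Un_disjoint[symmetric]) (auto simp: G_def intro!: arg_cong[of _ _ card])
  ultimately have cF: "card F = card F0 + card F1" by simp
  define S0 where "S0 = {S. S \<subseteq> X \<and> shatters F0 S}"
  define S1 where "S1 = {S. S \<subseteq> X \<and> shatters F1 S}"
  have finS: "finite S0" "finite S1" using insert.hyps(1) by (auto simp: S0_def S1_def)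
  have "S0 \<subseteq> {S. S \<subseteq> insert x X \<and> shatters F S}"
  proof
    fix S assume S: "S \<in> S0"
    then have "x \<notin> S" using insert.hyps by (auto simp: S0_def)
    then have "(A - {x}) \<inter> S = A \<inter> S" for A by auto
    then show "S \<in> {S. S \<subseteq> insert x X \<and> shatters F S}"
      using S by (auto simp: S0_def F0_def shatters_def)
  qed
  moreover have "insert x ` S1 \<subseteq> {S. S \<subseteq> insert x X \<and> shatters F S}"
  proof clarify
    fix S assume S: "S \<in> S1"
    then have xS: "x \<notin> S" using insert.hyps by (auto simp: S1_def)
    have "\<exists>A\<in>F. A \<inter> insert x S = T" if T: "T \<subseteq> insert x S" for T
    proof -
      have "T - {x} \<subseteq> S" using T by auto
      then obtain A where A: "A \<in> F1" "A \<inter> S = T - {x}"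
        using S unfolding S1_def shatters_def by blast
      show ?thesis
      proof (cases "x \<in> T")
        case True
        then have "insert x A \<inter> insert x S = T" using A by auto
        moreover have "insert x A \<in> F" using A by (simp add: F1_def)
        ultimately show ?thesis by blast
      next
        case False
        moreover have "x \<notin> A" using A by (simp add: F1_def)
        ultimately have "A \<inter> insert x S = T" using A by simp
        moreover have "A \<in> F" using A by (simp add: F1_def)
        ultimately show ?thesis by blast
      qed
    qed
    then show "insert x S \<subseteq> insert x X \<and> shatters F (insert x S)"
      using S by (auto simp: S1_def shatters_def)
  qed
  ultimately have "card (S0 \<union> insert x ` S1) \<le> card {S. S \<subseteq> insert x X \<and> shatters F S}"
    using insert.hyps(1) by (intro card_mono) auto
  moreover have "card (S0 \<union> insert x ` S1) = card S0 + card S1"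
  proof -
    have "inj_on (insert x) S1" using insert.hyps(2)
      by (intro inj_onI) (metis (no_types, lifting) S1_def insert_ident mem_Collect_eq subsetD)
    moreover have "S0 \<inter> insert x ` S1 = {}" using insert.hyps(2) by (auto simp: S0_def)
    ultimately show ?thesis using finS by (simp add: card_Un_disjoint card_image)
  qed
  moreover have "card F0 \<le> card S0" "card F1 \<le> card S1"
    using insert.IH sub by (auto simp: S0_def S1_def)
  ultimately show ?case using cF by linarith
qed

lemma sauer_shelah:
  assumes "finite X" "F \<subseteq> Pow X" "\<And>S. S \<subseteq> X \<Longrightarrow> shatters F S \<Longrightarrow> card S \<le> d"
  shows "card F \<le> (\<Sum>i\<le>d. card X choose i)"
proof -
  have "card F \<le> card {S. S \<subseteq> X \<and> shatters F S}"
    by (rule card_le_card_shattered) fact+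
  also have "\<dots> \<le> card (\<Union>i\<le>d. {S. S \<subseteq> X \<and> card S = i})"
    using assms by (intro card_mono) auto
  also have "\<dots> \<le> (\<Sum>i\<le>d. card {S. S \<subseteq> X \<and> card S = i})"
    by (rule card_UN_le) auto
  finally show ?thesis using assms(1) by (simp add: n_subsets)
qed

text \<open>For i \<le> d the weight x^(i-d) is at least 1; inserting it and extending the sum to
  all i gives a full binomial expansion. The parameter \<open>x\<close> is left free to be tuned
  against the sample size.\<close>

lemma sum_binomial_le:
  fixes x :: real
  assumes "0 < x" "x \<le> 1"
  shows "(\<Sum>i\<le>d. real (m choose i)) \<le> (1 / x) ^ d * (1 + x) ^ m"
proof -
  have "(\<Sum>i\<le>d. real (m choose i)) = (\<Sum>i\<in>{..d} \<inter> {..m}. real (m choose i))"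
    by (rule sum.mono_neutral_right) auto
  also have "\<dots> \<le> (\<Sum>i\<in>{..d} \<inter> {..m}. (1 / x) ^ d * (real (m choose i) * x ^ i))"
  proof (rule sum_mono)
    fix i assume "i \<in> {..d} \<inter> {..m}"
    then have "x ^ d \<le> x ^ i" using assms by (intro power_decreasing) auto
    then have "1 \<le> (1 / x) ^ d * x ^ i" using assms by (simp add: field_simps)
    then have "real (m choose i) * 1 \<le> real (m choose i) * ((1 / x) ^ d * x ^ i)"
      by (intro mult_left_mono) auto
    then show "real (m choose i) \<le> (1 / x) ^ d * (real (m choose i) * x ^ i)"
      by (simp add: mult_ac)
  qed
  also have "\<dots> \<le> (\<Sum>i\<le>m. (1 / x) ^ d * (real (m choose i) * x ^ i))"
    using assms by (intro sum_mono2) auto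
  also have "\<dots> = (1 / x) ^ d * (1 + x) ^ m"
    by (simp add: binomial_ring[of x 1 m] add.commute[of 1 x] sum_distrib_left)
  finally show ?thesis .
qed

section \<open>Affine dependence and the shattering power of halfspaces\<close>

text \<open>Gaussian elimination on the last coordinate with pivot \<open>k\<close>. The family is
  indexed, so coinciding vectors, such as repeated sample points, need no separate
  treatment.\<close>

lemma exists_linear_dependence:
  fixes v :: "'a \<Rightarrow> nat \<Rightarrow> real"
  assumes "finite I" "card I > d"
  shows "\<exists>a. (\<exists>i\<in>I. a i \<noteq> 0) \<and> (\<forall>j<d. (\<Sum>i\<in>I. a i * v i j) = 0)"
  using assms
proof (induction d arbitrary: I v)
  case 0
  then have "I \<noteq> {}" by auto
  then show ?case by (intro exI[of _ "\<lambda>_. 1"]) auto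
next
  case (Suc d)
  show ?case
  proof (cases "\<forall>i\<in>I. v i d = 0")
    case True
    then have "(\<Sum>i\<in>I. a i * v i d) = 0" for a by (simp add: sum.neutral)
    moreover obtain a where "\<exists>i\<in>I. a i \<noteq> 0" "\<forall>j<d. (\<Sum>i\<in>I. a i * v i j) = 0"
      using Suc.IH[of I v] Suc.prems by auto
    ultimately show ?thesis by (intro exI[of _ a]) (auto simp: less_Suc_eq)
  next
    case False
    then obtain k where k: "k \<in> I" "v k d \<noteq> 0" by auto
    define w where "w i j = v i j - v i d / v k d * v k j" for i j
    have "card (I - {k}) > d" using Suc.prems k by (simp add: card_Diff_singleton)
    then obtain a where a: "\<exists>i\<in>I - {k}. a i \<noteq> 0" "\<forall>j<d. (\<Sum>i\<in>I - {k}. a i * w i j) = 0"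
      using Suc.IH[of "I - {k}" w] Suc.prems by auto
    \<comment> \<open>The coefficient of the pivot is chosen so that the combination of the
      \<open>v i\<close> with weights \<open>b\<close> is the combination of the reduced vectors
      \<open>w i\<close> with weights \<open>a\<close>.\<close>
    define b where "b = a(k := - (\<Sum>i\<in>I - {k}. a i * v i d / v k d))"
    have "(\<Sum>i\<in>I. b i * v i j) = (\<Sum>i\<in>I - {k}. a i * w i j)" for j
    proof -
      have "(\<Sum>i\<in>I. b i * v i j) = b k * v k j + (\<Sum>i\<in>I - {k}. b i * v i j)"
        using k Suc.prems by (simp add: sum.remove)
      also have "(\<Sum>i\<in>I - {k}. b i * v i j) = (\<Sum>i\<in>I - {k}. a i * v i j)"
        by (intro sum.cong) (auto simp: b_def)
      also have "b k * v k j = - (\<Sum>i\<in>I - {k}. a i * v i d / v k d * v k j)"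
        by (simp add: b_def sum_distrib_right)
      finally show ?thesis
        by (simp add: w_def right_diff_distrib sum_subtractf) (simp add: ac_simps)
    qed
    moreover have "(\<Sum>i\<in>I - {k}. a i * w i d) = 0" using k by (simp add: w_def)
    ultimately have "\<forall>j<Suc d. (\<Sum>i\<in>I. b i * v i j) = 0"
      using a by (auto simp: less_Suc_eq)
    moreover have "\<exists>i\<in>I. b i \<noteq> 0" using a(1) by (auto simp: b_def)
    ultimately show ?thesis by blast
  qed
qed

text \<open>Coordinates from \<open>n\<close> on do not enter, so directions need not be extensional
  and the value \<open>undefined\<close> outside the domain does no harm.\<close>

definition ip :: "nat \<Rightarrow> point \<Rightarrow> point \<Rightarrow> real" where
  "ip n x y = (\<Sum>i<n. x i * y i)"

text \<open>The argument behind Radon's theorem: more than n + 1 points carry an affine dependence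
  \<open>a\<close>. A halfspace that cuts out exactly the points with positive coefficient would
  make the sum of \<open>a i * (ip n (z i) \<theta> - t \<theta>)\<close> positive, while the
  dependence makes it 0.\<close>

lemma halfspaces_not_shatter:
  assumes S: "finite S" and sh: "shatters ((\<lambda>\<theta>. {i \<in> X. ip n (z i) \<theta> \<ge> t \<theta>}) ` \<Theta>) S" "S \<subseteq> X"
  shows "card S \<le> n + 1"
proof (rule ccontr)
  assume "\<not> card S \<le> n + 1"
  \<comment> \<open>The additional coordinate 1 at index \<open>n\<close> turns a linear dependence
    into an affine one.\<close>
  then obtain a where a: "\<exists>i\<in>S. a i \<noteq> 0"
      "\<forall>j<n + 1. (\<Sum>i\<in>S. a i * (if j < n then z i j else 1)) = 0"
    using exists_linear_dependence[OF S, of "n + 1" "\<lambda>i j. if j < n then z i j else 1"] by force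
  have a0: "(\<Sum>i\<in>S. a i) = 0" using a(2) by (auto dest: spec[of _ n])
  have aj: "(\<Sum>i\<in>S. a i * z i j) = 0" if "j < n" for j
    using a(2) that by (auto dest: spec[of _ j])
  \<comment> \<open>Members of the halfspace satisfy only a weak inequality; strict positivity of
    the sum has to come from a point outside with negative coefficient.\<close>
  have "\<exists>i\<in>S. a i < 0"
  proof (rule ccontr)
    assume "\<not> ?thesis"
    then have "\<forall>i\<in>S. a i = 0" using a0 S by (subst (asm) sum_nonneg_eq_0_iff) (auto simp: not_less)
    then show False using a(1) by auto
  qed
  then obtain k where k: "k \<in> S" "a k < 0" by auto
  obtain \<theta> where \<theta>: "{i \<in> X. ip n (z i) \<theta> \<ge> t \<theta>} \<inter> S = {i \<in> S. a i > 0}"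
    using sh(1) unfolding shatters_def by (auto dest: spec[of _ "{i \<in> S. a i > 0}"])
  have mem: "ip n (z i) \<theta> \<ge> t \<theta> \<longleftrightarrow> a i > 0" if "i \<in> S" for i
    using \<theta> that sh(2) by auto
  have "(\<Sum>i\<in>S. a i * (ip n (z i) \<theta> - t \<theta>)) = (\<Sum>i\<in>S. \<Sum>j<n. a i * z i j * \<theta> j)"
    using a0 by (simp add: ip_def right_diff_distrib sum_subtractf flip: sum_distrib_right)
       (simp add: sum_distrib_left mult.assoc)
  also have "\<dots> = (\<Sum>j<n. \<Sum>i\<in>S. a i * z i j * \<theta> j)" by (rule sum.swap)
  also have "\<dots> = 0" by (simp add: aj flip: sum_distrib_right)
  finally have "(\<Sum>i\<in>S. a i * (ip n (z i) \<theta> - t \<theta>)) = 0" .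
  moreover have "(\<Sum>i\<in>S. a i * (ip n (z i) \<theta> - t \<theta>)) > 0"
  proof (rule sum_pos2[OF S k(1)])
    show "0 < a k * (ip n (z k) \<theta> - t \<theta>)"
      using k mem[of k] by (intro mult_neg_neg) auto
    show "0 \<le> a i * (ip n (z i) \<theta> - t \<theta>)" if "i \<in> S" for i
      using mem[OF that] by (cases "a i > 0") (auto intro!: mult_nonpos_nonpos)
  qed
  ultimately show False by simp
qed

lemma card_halfspace_traces_le:
  "card ((\<lambda>\<theta>. {i\<in>{..<m}. ip n (z i) \<theta> \<ge> t \<theta>}) ` \<Theta>) \<le> (\<Sum>i\<le>n + 1. m choose i)"
proof -
  let ?F = "(\<lambda>\<theta>. {i\<in>{..<m}. ip n (z i) \<theta> \<ge> t \<theta>}) ` \<Theta>"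
  have "card ?F \<le> (\<Sum>i\<le>n + 1. card {..<m} choose i)"
  proof (rule sauer_shelah)
    fix S assume S: "S \<subseteq> {..<m}" "shatters ?F S"
    then have "finite S" by (auto intro: finite_subset)
    then show "card S \<le> n + 1" by (rule halfspaces_not_shatter) (rule S)+
  qed auto
  then show ?thesis by simp
qed

section \<open>Double sampling\<close>

lemma binomial_mono_upper: "m \<le> n \<Longrightarrow> m choose k \<le> n choose k"
proof (induction n rule: dec_induct)
  case (step n)
  then show ?case by (cases k) auto
qed simp

text \<open>A uniformly random \<open>N\<close>-subset of \<open>2 * N\<close> points avoids
  \<open>k\<close> given points with probability at most 2^(-k). Each further forbidden point costs
  a factor (m - N) / m, which is at most 1/2 because m \<le> 2N.\<close>

lemma binomial_halving:
  assumes "k \<le> 2 * N"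
  shows "((2 * N - k) choose N) * 2 ^ k \<le> (2 * N) choose N"
  using assms
proof (induction k)
  case (Suc k)
  define m where "m = 2 * N - k"
  have m: "m \<ge> 1" "2 * N - Suc k = m - 1" "2 * (m - N) \<le> m" using Suc.prems by (auto simp: m_def)
  have "m * (2 * ((m - 1) choose N)) = 2 * (m - N) * (m choose N)"
    using binomial_absorb_comp[of m N] by simp
  also have "\<dots> \<le> m * (m choose N)" using m by (intro mult_right_mono) auto
  finally have "2 * ((m - 1) choose N) \<le> m choose N" using m by simp
  then have "2 * ((m - 1) choose N) * 2 ^ k \<le> (m choose N) * 2 ^ k" by (rule mult_right_mono) simp
  also have "\<dots> \<le> (2 * N) choose N" using Suc by (simp add: m_def)
  finally show ?case unfolding m(2) by (simp add: mult_ac)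
qed simp

text \<open>A reverse Markov inequality: the number of hits has mean at least \<epsilon> |J|, is at
  most |J| on the event and at most \<open>k\<close> off it, and \<open>k\<close> is at most half of
  that mean. No variance has to be computed.\<close>

lemma prob_many_hits_ge:
  assumes "prob_space M" "finite J" "J \<noteq> {}" "H \<in> sets M" "\<epsilon> \<le> measure M H"
    and "2 * real k \<le> \<epsilon> * card J"
  shows "measure (\<Pi>\<^sub>M j\<in>J. M) {y \<in> space (\<Pi>\<^sub>M j\<in>J. M). real k \<le> (\<Sum>j\<in>J. indicator H (y j))} \<ge> \<epsilon> / 2"
proof -
  let ?P = "\<Pi>\<^sub>M j\<in>J. M"
  let ?C = "{y \<in> space ?P. real k \<le> (\<Sum>j\<in>J. indicator H (y j))}"
  interpret P: prob_space ?P by (intro prob_space_PiM assms)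
  note [measurable] = assms(4)
  have C: "?C \<in> sets ?P" by measurable
  have comp: "P.prob {y \<in> space ?P. y j \<in> H} = measure M H" if "j \<in> J" for j
  proof -
    have "measure M H = measure (distr ?P M (\<lambda>\<omega>. \<omega> j)) H"
      using that assms(1) by (subst distr_PiM_component) auto
    also have "\<dots> = P.prob {y \<in> space ?P. y j \<in> H}"
      using that by (subst measure_distr) (auto intro!: arg_cong[of _ _ P.prob])
    finally show ?thesis by simp
  qed
  have int: "integrable ?P (\<lambda>y. indicator H (y j) :: real)" if "j \<in> J" for j
    using that by (intro P.integrable_const_bound[where B = 1]) auto
  have "\<epsilon> * card J \<le> (\<Sum>j\<in>J. measure M H)" using assms(5) by (simp add: mult.commute[of \<epsilon>] mult_left_mono)
  also have "\<dots> = (\<Sum>j\<in>J. P.expectation (\<lambda>y. indicator H (y j)))"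
  proof (rule sum.cong)
    fix j assume j: "j \<in> J"
    have "P.expectation (\<lambda>y. indicator H (y j)) = P.expectation (indicator {y \<in> space ?P. y j \<in> H})"
      by (intro Bochner_Integration.integral_cong) (auto simp: indicator_def)
    also have "\<dots> = measure M H" using comp[OF j] j by simp
    finally show "measure M H = P.expectation (\<lambda>y. indicator H (y j))" by simp
  qed simp
  also have "\<dots> = P.expectation (\<lambda>y. \<Sum>j\<in>J. indicator H (y j))"
    using int by (subst Bochner_Integration.integral_sum) auto
  also have "\<dots> \<le> P.expectation (\<lambda>y. real (card J) * indicat_real ?C y + real k)"
  proof (rule integral_mono)
    show "integrable ?P (\<lambda>y. \<Sum>j\<in>J. indicator H (y j) :: real)" using int by auto
    show "integrable ?P (\<lambda>y. real (card J) * indicat_real ?C y + real k)"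
      using C by (intro Bochner_Integration.integrable_add integrable_mult_right integrable_real_indicator)
        (auto simp: P.emeasure_eq_measure)
    fix y assume "y \<in> space ?P"
    moreover have "(\<Sum>j\<in>J. indicator H (y j) :: real) \<le> (\<Sum>j\<in>J. 1)"
      by (intro sum_mono) (auto simp: indicator_def)
    ultimately show "(\<Sum>j\<in>J. indicator H (y j)) \<le> real (card J) * indicat_real ?C y + real k"
      by (auto simp: indicator_def[of ?C])
  qed
  also have "\<dots> = card J * P.prob ?C + k" using C
    by (subst Bochner_Integration.integral_add)
      (auto intro!: integrable_mult_right integrable_real_indicator simp: P.prob_space P.emeasure_eq_measure)
  finally have "card J * (\<epsilon> / 2) \<le> card J * P.prob ?C"
    using assms(6) by (simp add: mult.commute[of \<epsilon>])
  moreover have "card J > 0" using assms(2,3) by (simp add: card_gt_0_iff)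
  ultimately show ?thesis by simp
qed

lemma exists_permutation_image:
  assumes "I \<subseteq> {..<2 * N}" "card I = N"
  shows "\<exists>\<pi>. bij_betw \<pi> {..<2 * N} {..<2 * N::nat} \<and> \<pi> ` {..<N} = I"
proof -
  have fin: "finite I" using assms finite_subset by blast
  obtain f where f: "bij_betw f {..<N} I"
    using finite_same_card_bij[of "{..<N}" I] fin assms by auto
  have "card ({..<2 * N} - I) = card {N..<2 * N}" using assms fin by (simp add: card_Diff_subset)
  then obtain g where g: "bij_betw g {N..<2 * N} ({..<2 * N} - I)"
    using finite_same_card_bij[of "{N..<2 * N}" "{..<2 * N} - I"] by auto
  define \<pi> where "\<pi> i = (if i \<in> {..<N} then f i else g i)" for i
  have "bij_betw \<pi> ({..<N} \<union> {N..<2 * N}) (I \<union> ({..<2 * N} - I))"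
    unfolding \<pi>_def by (intro bij_betw_disjoint_Un f g) auto
  moreover have "{..<N} \<union> {N..<2 * N} = {..<2 * N}" "I \<union> ({..<2 * N} - I) = {..<2 * N}"
    using assms by auto
  moreover have "\<pi> ` {..<N} = I" using f by (auto simp: \<pi>_def bij_betw_def)
  ultimately show ?thesis by auto
qed

text \<open>
  Given a sample missing some \<open>H \<in> \<H>\<close>, an independent second sample of size \<open>N\<close> still hits \<open>H\<close> at
  least \<open>k\<close> times with probability at least \<open>\<epsilon> / 2\<close>. By exchangeability, which \<open>N\<close> of the \<open>2N\<close> points
  form the first sample can be chosen uniformly at random after the points are drawn; then only the
  at most \<open>G\<close> traces of \<open>\<H>\<close> on them matter, and each trace of size at least \<open>k\<close> is avoided with
  probability at most \<open>2\<^sup>-\<^sup>k\<close>.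
\<close>

locale ghost_sample = prob_space M for M :: "'a measure" +
  fixes \<H> :: "'a set set" and N k G :: nat and \<epsilon> :: real
  assumes countable: "countable \<H>" and sets_\<H>: "\<And>H. H \<in> \<H> \<Longrightarrow> H \<in> sets M"
    and large: "\<And>H. H \<in> \<H> \<Longrightarrow> \<epsilon> \<le> measure M H" and pos: "N > 0" "\<epsilon> > 0"
    and few: "2 * real k \<le> \<epsilon> * N" "k \<le> 2 * N"
    and growth: "\<And>z. z \<in> space (\<Pi>\<^sub>M i\<in>{..<2 * N}. M) \<Longrightarrow>
      card ((\<lambda>H. {i\<in>{..<2 * N}. z i \<in> H}) ` \<H>) \<le> G"
begin

abbreviation "P1 \<equiv> \<Pi>\<^sub>M i\<in>{..<N}. M"
abbreviation "P2 \<equiv> \<Pi>\<^sub>M i\<in>{..<2 * N}. M"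

definition missed where
  "missed = {x \<in> space P1. \<exists>H\<in>\<H>. \<forall>i<N. x i \<notin> H}"

text \<open>The hits are counted over all \<open>2 * N\<close> points and not only over those
  outside \<open>I\<close>. This makes the second condition invariant under permutations, so that
  \<open>I\<close> enters only through the avoidance condition.\<close>

definition split_event where
  "split_event I = {z \<in> space P2. \<exists>H\<in>\<H>. (\<forall>i\<in>I. z i \<notin> H) \<and> real k \<le> (\<Sum>i<2*N. indicator H (z i))}"

lemma sets_missed [measurable]: "missed \<in> sets P1"
proof -
  have "missed = (\<Union>H\<in>\<H>. {x \<in> space P1. \<forall>i\<in>{..<N}. x i \<notin> H})"
    by (auto simp: missed_def)
  moreover have "{x \<in> space P1. \<forall>i\<in>{..<N}. x i \<notin> H} \<in> sets P1" if "H \<in> \<H>" for H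
  proof -
    note [measurable] = sets_\<H>[OF that]
    show ?thesis by measurable
  qed
  ultimately show ?thesis using countable by auto
qed

lemma sets_split_event: "I \<subseteq> {..<2 * N} \<Longrightarrow> split_event I \<in> sets P2"
proof -
  assume I: "I \<subseteq> {..<2 * N}"
  then have [simp]: "finite I" using finite_subset by blast
  have "split_event I = (\<Union>H\<in>\<H>. {z \<in> space P2. (\<forall>i\<in>I. z i \<notin> H) \<and> real k \<le> (\<Sum>i<2*N. indicator H (z i))})"
    by (auto simp: split_event_def)
  moreover have "{z \<in> space P2. (\<forall>i\<in>I. z i \<notin> H) \<and> real k \<le> (\<Sum>i<2*N. indicator H (z i))} \<in> sets P2"
    if "H \<in> \<H>" for H
  proof -
    note [measurable] = sets_\<H>[OF that]
    have "{z \<in> space P2. z i \<notin> H} \<in> sets P2" if "i \<in> I" for i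
    proof -
      have [measurable]: "(\<lambda>z. z i) \<in> measurable P2 M"
        using that I by (intro measurable_component_singleton) auto
      show ?thesis by measurable
    qed
    then have 1: "{z \<in> space P2. \<forall>i\<in>I. z i \<notin> H} \<in> sets P2"
      by (intro sets.sets_Collect_finite_All) auto
    have 2: "{z \<in> space P2. real k \<le> (\<Sum>i<2*N. indicator H (z i))} \<in> sets P2"
      by measurable
    show ?thesis by (intro sets.sets_Collect_conj 1 2)
  qed
  ultimately show ?thesis using countable by auto
qed

text \<open>Fubini over the two halves of the double sample: above each \<open>x\<close> in
  \<open>missed\<close>, the section of the split event has probability at least \<epsilon> /
  2.\<close>

lemma prob_missed_le_split: "\<epsilon> / 2 * measure P1 missed \<le> measure P2 (split_event {..<N})"
proof -
  interpret S: product_sigma_finite "\<lambda>_::nat. M" by standard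
  interpret Q1: prob_space P1 by (intro prob_space_PiM) (rule prob_space_axioms)
  interpret Q2: prob_space P2 by (intro prob_space_PiM) (rule prob_space_axioms)
  let ?J = "{N..<2 * N}"
  let ?Q = "\<Pi>\<^sub>M i\<in>?J. M"
  interpret Q: prob_space ?Q by (intro prob_space_PiM) (rule prob_space_axioms)
  have J: "{..<N} \<union> ?J = {..<2 * N}" by auto
  have ev: "split_event {..<N} \<in> sets P2" by (rule sets_split_event) auto
  have "ennreal (\<epsilon> / 2 * measure P1 missed) = (\<integral>\<^sup>+x. ennreal (\<epsilon> / 2) * indicator missed x \<partial>P1)"
    using pos by (subst nn_integral_cmult_indicator)
      (auto simp: Q1.emeasure_eq_measure ennreal_mult'[symmetric])
  also have "\<dots> \<le> (\<integral>\<^sup>+x. (\<integral>\<^sup>+y. indicator (split_event {..<N}) (merge {..<N} ?J (x, y)) \<partial>?Q) \<partial>P1)"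
  proof (rule nn_integral_mono)
    fix x assume x: "x \<in> space P1"
    show "ennreal (\<epsilon> / 2) * indicator missed x
      \<le> (\<integral>\<^sup>+y. indicator (split_event {..<N}) (merge {..<N} ?J (x, y)) \<partial>?Q)"
    proof (cases "x \<in> missed")
      case True
      \<comment> \<open>Only the inner integral is estimated, for each \<open>x\<close> separately,
        so \<open>H\<close> may depend on \<open>x\<close> in an arbitrary way.\<close>
      then obtain H where H: "H \<in> \<H>" "\<forall>i<N. x i \<notin> H" by (auto simp: missed_def)
      note [measurable] = sets_\<H>[OF H(1)]
      let ?C = "{y \<in> space ?Q. real k \<le> (\<Sum>j\<in>?J. indicator H (y j))}"
      have "ennreal (\<epsilon> / 2) \<le> ennreal (measure ?Q ?C)"
        using H sets_\<H> large few(1) pos prob_space_axioms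
        by (intro ennreal_leI prob_many_hits_ge) auto
      also have "\<dots> = (\<integral>\<^sup>+y. indicator ?C y \<partial>?Q)"
        by (subst nn_integral_indicator) (auto simp: Q.emeasure_eq_measure)
      also have "\<dots> \<le> (\<integral>\<^sup>+y. indicator (split_event {..<N}) (merge {..<N} ?J (x, y)) \<partial>?Q)"
      proof (rule nn_integral_mono)
        fix y assume y: "y \<in> space ?Q"
        have "merge {..<N} ?J (x, y) \<in> split_event {..<N}" if C: "y \<in> ?C"
        proof -
          have sp: "merge {..<N} ?J (x, y) \<in> space P2"
            using measurable_space[OF measurable_merge[of "{..<N}" ?J "\<lambda>_. M"], of "(x, y)"] x y J
            by (simp add: space_pair_measure)
          have "real k \<le> (\<Sum>j\<in>?J. indicator H (y j))" using C by simp
          also have "\<dots> = (\<Sum>j\<in>?J. indicator H (merge {..<N} ?J (x, y) j))"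
            by (intro sum.cong) (auto simp: merge_def)
          also have "\<dots> \<le> (\<Sum>j<2*N. indicator H (merge {..<N} ?J (x, y) j))"
            by (intro sum_mono2) auto
          finally show ?thesis
            using H sp by (auto simp: split_event_def merge_def)
        qed
        then show "indicator ?C y \<le> (indicator (split_event {..<N}) (merge {..<N} ?J (x, y)) :: ennreal)"
          by (auto simp: indicator_def)
      qed
      finally show ?thesis using True by simp
    qed simp
  qed
  also have "\<dots> = (\<integral>\<^sup>+z. indicator (split_event {..<N}) z \<partial>(\<Pi>\<^sub>M i\<in>{..<N} \<union> ?J. M))"
    using ev by (subst S.product_nn_integral_fold) (auto simp: J)
  also have "\<dots> = ennreal (measure P2 (split_event {..<N}))"
    using ev by (simp add: J Q2.emeasure_eq_measure)
  finally show ?thesis by simp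
qed

text \<open>Exchangeability: a permutation of the coordinates that carries the first
  \<open>N\<close> indices onto \<open>I\<close> preserves the product measure and carries one event
  to the other.\<close>

lemma measure_split_event_eq:
  assumes I: "I \<subseteq> {..<2 * N}" "card I = N"
  shows "measure P2 (split_event I) = measure P2 (split_event {..<N})"
proof -
  obtain \<pi> where \<pi>: "bij_betw \<pi> {..<2 * N} {..<2 * N}" "\<pi> ` {..<N} = I"
    using exists_permutation_image[OF I] by auto
  define T where "T \<omega> = (\<lambda>i\<in>{..<2 * N}. \<omega> (\<pi> i))" for \<omega> :: "nat \<Rightarrow> 'a"
  have \<pi>': "\<pi> i < 2 * N" if "i < 2 * N" for i using \<pi> that by (auto simp: bij_betw_def)
  have T[measurable]: "T \<in> measurable P2 P2" unfolding T_def
    by (rule measurable_restrict) (use \<pi>' in auto)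
  have "distr P2 P2 T = P2"
    unfolding T_def using \<pi> prob_space_axioms
    by (intro distr_PiM_reindex[where M = "\<lambda>_. M"]) (auto simp: bij_betw_def)
  then have "measure P2 (split_event {..<N}) = measure (distr P2 P2 T) (split_event {..<N})" by simp
  also have "\<dots> = measure P2 (T -` split_event {..<N} \<inter> space P2)"
    by (rule measure_distr) (auto intro!: sets_split_event)
  also have "T -` split_event {..<N} \<inter> space P2 = split_event I"
  proof -
    have "T z \<in> split_event {..<N} \<longleftrightarrow> z \<in> split_event I" if z: "z \<in> space P2" for z
    proof -
      have "T z \<in> space P2" using measurable_space[OF T z] .
      moreover have "(\<forall>i\<in>{..<N}. T z i \<notin> H) \<longleftrightarrow> (\<forall>i\<in>I. z i \<notin> H)" for H
        using \<pi>(2)[symmetric] by (auto simp: T_def)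
      moreover have "(\<Sum>i<2*N. indicator H (T z i)) = (\<Sum>i<2*N. indicator H (z i) :: real)" for H
      proof -
        have "(\<Sum>i<2*N. indicator H (T z i) :: real) = (\<Sum>i<2*N. indicator H (z (\<pi> i)))"
          by (intro sum.cong) (auto simp: T_def)
        also have "\<dots> = (\<Sum>i<2*N. indicator H (z i))"
          by (rule sum.reindex_bij_betw[OF \<pi>(1)])
        finally show ?thesis .
      qed
      ultimately show ?thesis using z by (auto simp: split_event_def)
    qed
    moreover have "split_event I \<subseteq> space P2" by (auto simp: split_event_def)
    ultimately show ?thesis by auto
  qed
  finally show ?thesis by simp
qed

text \<open>With the points fixed, a witness \<open>H\<close> matters only through its trace \<tau>
  on the indices. A split for which \<open>H\<close> is a witness lies in the complement of \<tau>,
  and \<tau> has at least \<open>k\<close> elements.\<close>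

lemma card_splits_le:
  assumes z: "z \<in> space P2"
  shows "card {I. I \<subseteq> {..<2 * N} \<and> card I = N \<and> z \<in> split_event I} \<le> G * ((2 * N - k) choose N)"
proof -
  let ?T = "(\<lambda>H. {i\<in>{..<2 * N}. z i \<in> H}) ` \<H>"
  have T: "?T \<subseteq> Pow {..<2 * N}" by auto
  have finT: "finite ?T" by (rule finite_subset[OF T]) simp
  let ?U = "\<Union>\<tau>\<in>{\<tau>\<in>?T. k \<le> card \<tau>}. {I. I \<subseteq> {..<2 * N} - \<tau> \<and> card I = N}"
  have "{I. I \<subseteq> {..<2 * N} \<and> card I = N \<and> z \<in> split_event I} \<subseteq> ?U"
  proof
    fix I assume "I \<in> {I. I \<subseteq> {..<2 * N} \<and> card I = N \<and> z \<in> split_event I}"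
    then have I: "I \<subseteq> {..<2 * N}" "card I = N" "z \<in> split_event I" by auto
    from I(3) obtain H where H: "H \<in> \<H>" "\<forall>i\<in>I. z i \<notin> H" "real k \<le> (\<Sum>i<2*N. indicator H (z i))"
      by (auto simp: split_event_def)
    have "(\<Sum>i<2*N. indicator H (z i) :: real) = card {i\<in>{..<2 * N}. z i \<in> H}"
      by (simp add: indicator_def sum.If_cases Int_def)
    then show "I \<in> ?U" using H I by (intro UN_I[of "{i\<in>{..<2 * N}. z i \<in> H}"]) auto
  qed
  then have "card {I. I \<subseteq> {..<2 * N} \<and> card I = N \<and> z \<in> split_event I} \<le> card ?U"
    using finT by (intro card_mono) auto
  also have "\<dots> \<le> (\<Sum>\<tau>\<in>{\<tau>\<in>?T. k \<le> card \<tau>}. card {I. I \<subseteq> {..<2 * N} - \<tau> \<and> card I = N})"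
    using finT by (intro card_UN_le) auto
  also have "\<dots> \<le> (\<Sum>\<tau>\<in>{\<tau>\<in>?T. k \<le> card \<tau>}. (2 * N - k) choose N)"
  proof (rule sum_mono)
    fix \<tau> assume \<tau>: "\<tau> \<in> {\<tau>\<in>?T. k \<le> card \<tau>}"
    then have "\<tau> \<subseteq> {..<2 * N}" by auto
    then have "card ({..<2 * N} - \<tau>) = 2 * N - card \<tau>"
      by (subst card_Diff_subset) (auto intro: finite_subset)
    then show "card {I. I \<subseteq> {..<2 * N} - \<tau> \<and> card I = N} \<le> (2 * N - k) choose N"
      using \<tau> by (auto simp: n_subsets intro!: binomial_mono_upper)
  qed
  also have "\<dots> = card {\<tau>\<in>?T. k \<le> card \<tau>} * ((2 * N - k) choose N)" by simp
  also have "\<dots> \<le> G * ((2 * N - k) choose N)"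
    using growth[OF z] card_mono[OF finT, of "{\<tau>\<in>?T. k \<le> card \<tau>}"] by (intro mult_right_mono) auto
  finally show ?thesis .
qed

text \<open>Double counting: all splits have the same probability, so it equals the expected
  proportion of splits whose event occurs, and this proportion is bounded for every
  \<open>z\<close>.\<close>

lemma prob_split_le: "measure P2 (split_event {..<N}) \<le> G / 2 ^ k"
proof -
  interpret Q2: prob_space P2 by (intro prob_space_PiM) (rule prob_space_axioms)
  let ?S = "{I. I \<subseteq> {..<2 * N} \<and> card I = N}"
  let ?m = "measure P2 (split_event {..<N})"
  have fin: "finite ?S" by simp
  have int: "integrable P2 (indicator (split_event I) :: _ \<Rightarrow> real)" if "I \<in> ?S" for I
    using sets_split_event[of I] that by (intro integrable_real_indicator) (simp_all add: Q2.emeasure_eq_measure)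
  have "real ((2 * N) choose N) * ?m = (\<Sum>I\<in>?S. ?m)"
    by (simp add: n_subsets)
  also have "\<dots> = (\<Sum>I\<in>?S. Q2.expectation (indicator (split_event I)))"
  proof (intro sum.cong refl)
    fix I assume "I \<in> ?S"
    then show "?m = Q2.expectation (indicator (split_event I))"
      using measure_split_event_eq[of I] sets_split_event[of I] by simp
  qed
  also have "\<dots> = Q2.expectation (\<lambda>z. \<Sum>I\<in>?S. indicator (split_event I) z)"
    by (subst Bochner_Integration.integral_sum) (rule int, assumption, rule refl)
  also have "\<dots> \<le> Q2.expectation (\<lambda>z. real (G * ((2 * N - k) choose N)))"
  proof (rule integral_mono)
    fix z assume z: "z \<in> space P2"
    have "(\<Sum>I\<in>?S. indicator (split_event I) z :: real) = card {I. I \<subseteq> {..<2 * N} \<and> card I = N \<and> z \<in> split_event I}"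
      using fin by (simp add: indicator_def sum.If_cases Int_def conj_assoc)
    then show "(\<Sum>I\<in>?S. indicator (split_event I) z) \<le> real (G * ((2 * N - k) choose N))"
      using card_splits_le[OF z] by (simp del: of_nat_mult)
  next
    show "integrable P2 (\<lambda>z. \<Sum>I\<in>?S. indicator (split_event I) z :: real)"
      by (rule Bochner_Integration.integrable_sum) (rule int)
  qed simp
  also have "\<dots> = real G * real ((2 * N - k) choose N)" by (simp add: Q2.prob_space)
  also have "\<dots> \<le> real G * (real ((2 * N) choose N) / 2 ^ k)"
  proof -
    have "real (((2 * N - k) choose N) * 2 ^ k) \<le> real ((2 * N) choose N)"
      using binomial_halving[OF few(2)] by (simp del: of_nat_mult)
    then show ?thesis by (intro mult_left_mono) (auto simp: field_simps)
  qed
  finally have "real ((2 * N) choose N) * ?m \<le> real ((2 * N) choose N) * (G / 2 ^ k)" by (simp add: mult_ac)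
  moreover have "real ((2 * N) choose N) > 0" by simp
  ultimately show ?thesis by (rule mult_left_le_imp_le)
qed

lemma prob_missed_le: "measure P1 missed \<le> 2 / \<epsilon> * G / 2 ^ k"
proof -
  have "\<epsilon> / 2 * measure P1 missed \<le> G / 2 ^ k"
    using prob_missed_le_split prob_split_le by (rule order_trans)
  then show ?thesis using pos by (simp add: field_simps)
qed

end

section \<open>The Prekopa-Leindler inequality\<close>

text \<open>Provides cut points inside \<open>A\<close> that exhaust it from below, whether or not
  the supremum is finite or attained. Without a maximum, one point above each suitable rational is
  enough.\<close>

lemma countable_cofinal_subset:
  fixes A :: "real set"
  assumes "A \<noteq> {}"
  shows "\<exists>D\<subseteq>A. countable D \<and> D \<noteq> {} \<and> (\<forall>x\<in>A. \<exists>d\<in>D. x \<le> d)"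
proof (cases "\<exists>m\<in>A. \<forall>x\<in>A. x \<le> m")
  case True
  then obtain m where "m \<in> A" "\<forall>x\<in>A. x \<le> m" by auto
  then show ?thesis by (intro exI[of _ "{m}"]) auto
next
  case False
  define Q where "Q = {q\<in>\<rat>. \<exists>a\<in>A. q \<le> a}"
  define d where "d q = (SOME a. a \<in> A \<and> q \<le> a)" for q
  have d: "d q \<in> A" "q \<le> d q" if "q \<in> Q" for q
    using someI_ex[of "\<lambda>a. a \<in> A \<and> q \<le> a"] that by (auto simp: Q_def d_def)
  have dom: "\<exists>y\<in>d ` Q. x \<le> y" if x: "x \<in> A" for x
  proof -
    obtain a where a: "a \<in> A" "x < a" using False x by (auto simp: not_le)
    obtain q where q: "q \<in> \<rat>" "x < q" "q < a" using Rats_dense_in_real[OF a(2)] by auto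
    then have "q \<in> Q" using a by (auto simp: Q_def intro!: bexI[of _ a])
    then show ?thesis using d[of q] q by force
  qed
  have "countable (d ` Q)" using countable_rat by (auto simp: Q_def intro: countable_subset)
  moreover have "d ` Q \<noteq> {}" using dom assms by blast
  ultimately show ?thesis using d dom by (intro exI[of _ "d ` Q"]) auto
qed

text \<open>Replaces the usual approximation by compact sets: the argument on the line wants a
  largest element of \<open>A\<close>, which \<open>A \<inter> {..a}\<close> has, and these segments
  increase to \<open>A\<close>.\<close>

lemma emeasure_le_initial_segments:
  assumes [measurable]: "A \<in> sets borel" and "A \<noteq> {}"
    and bound: "\<And>a. a \<in> A \<Longrightarrow> emeasure lborel (A \<inter> {..a}) + u \<le> c"
  shows "emeasure lborel (A :: real set) + u \<le> c"
proof -
  obtain D where D: "D \<subseteq> A" "countable D" "D \<noteq> {}" "\<forall>x\<in>A. \<exists>d\<in>D. x \<le> d"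
    using countable_cofinal_subset[OF assms(2)] by auto
  define e where "e = from_nat_into D"
  have e: "range e = D" unfolding e_def using D by (simp add: range_from_nat_into)
  define s where "s n = Max (e ` {..n})" for n
  have sA: "s n \<in> A" for n
  proof -
    have "s n \<in> e ` {..n}" unfolding s_def by (rule Max_in) auto
    then show ?thesis using e D(1) by auto
  qed
  have mono: "s m \<le> s n" if "m \<le> n" for m n
    unfolding s_def using that by (intro Max_mono) auto
  have "incseq (\<lambda>n. A \<inter> {..s n})"
    unfolding incseq_def using mono by (auto intro: order_trans)
  then have "(\<lambda>n. emeasure lborel (A \<inter> {..s n})) \<longlonglongrightarrow> emeasure lborel (\<Union>n. A \<inter> {..s n})"
    by (intro Lim_emeasure_incseq) auto
  also have "(\<Union>n. A \<inter> {..s n}) = A"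
  proof -
    have "\<exists>n. x \<le> s n" if x: "x \<in> A" for x
    proof -
      obtain d where "d \<in> D" "x \<le> d" using D(4) x by auto
      moreover then obtain n where "d = e n" using e by auto
      ultimately have "x \<le> e n" by simp
      also have "e n \<le> s n" unfolding s_def by (intro Max_ge) auto
      finally show ?thesis by auto
    qed
    then show ?thesis by auto
  qed
  finally have "(\<lambda>n. emeasure lborel (A \<inter> {..s n}) + u) \<longlonglongrightarrow> emeasure lborel A + u"
    by (intro tendsto_add tendsto_const)
  then show ?thesis by (rule LIMSEQ_le_const2) (use bound sA in auto)
qed

lemma emeasure_uminus_vimage:
  assumes [measurable]: "B \<in> sets borel"
  shows "emeasure lborel (uminus -` B :: real set) = emeasure lborel B"
proof -
  have "emeasure lborel B = emeasure (distr lborel borel uminus) B"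
    by (simp add: lborel_distr_uminus)
  also have "\<dots> = emeasure lborel (uminus -` B)" by (subst emeasure_distr) auto
  finally show ?thesis by simp
qed

lemma emeasure_affine_le:
  fixes A C :: "real set"
  assumes [measurable]: "A \<in> sets borel" "C \<in> sets borel"
    and "\<And>x. x \<in> A \<Longrightarrow> (x + b) / 2 \<in> C"
  shows "emeasure lborel A \<le> 2 * emeasure lborel C"
proof -
  have "emeasure lborel A = (\<integral>\<^sup>+x. indicator A x \<partial>lborel)" by simp
  also have "\<dots> = ennreal \<bar>2\<bar> * (\<integral>\<^sup>+x. indicator A (- b + 2 * x) \<partial>lborel)"
    by (rule nn_integral_real_affine) auto
  also have "\<dots> \<le> 2 * (\<integral>\<^sup>+x. indicator C x \<partial>lborel)"
    using assms(3)[of "- b + 2 * _"] by (intro mult_mono nn_integral_mono) (auto simp: indicator_def)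
  finally show ?thesis by simp
qed

text \<open>If \<open>a\<close> is the largest element of \<open>A\<close> and \<open>b\<close> the
  least of \<open>B\<close>, then (A + b)/2 and (a + B)/2 both lie in \<open>C\<close>, on opposite
  sides of (a + b)/2. General sets are first cut at \<open>a\<close> and \<open>b\<close>, then the
  cuts are removed one at a time.\<close>

lemma brunn_minkowski_midpoint_real:
  fixes A B C :: "real set"
  assumes [measurable]: "A \<in> sets borel" "B \<in> sets borel" "C \<in> sets borel"
    and ne: "A \<noteq> {}" "B \<noteq> {}" and mid: "\<And>a b. a \<in> A \<Longrightarrow> b \<in> B \<Longrightarrow> (a + b) / 2 \<in> C"
  shows "emeasure lborel A + emeasure lborel B \<le> 2 * emeasure lborel C"
proof -
  have key: "emeasure lborel (A \<inter> {..a}) + emeasure lborel (B \<inter> {b..}) \<le> 2 * emeasure lborel C"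
    if a: "a \<in> A" and b: "b \<in> B" for a b
  proof -
    have "emeasure lborel (A \<inter> {..a}) \<le> 2 * emeasure lborel (C \<inter> {..(a + b) / 2})"
      using mid b by (intro emeasure_affine_le[where b = b]) auto
    moreover have "emeasure lborel (B \<inter> {b..}) \<le> 2 * emeasure lborel (C \<inter> {(a + b) / 2..})"
      using mid[OF a] by (intro emeasure_affine_le[where b = a]) (auto simp: add.commute[of _ a])
    \<comment> \<open>The two halves of \<open>C\<close> share only the midpoint, a null set;
      dropping it makes them disjoint.\<close>
    moreover have "emeasure lborel (C \<inter> {(a + b) / 2..}) = emeasure lborel (C \<inter> {(a + b) / 2<..})"
    proof (rule emeasure_eq_AE)
      show "AE x in lborel. (x \<in> C \<inter> {(a + b) / 2..}) = (x \<in> C \<inter> {(a + b) / 2<..})"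
        using AE_lborel_singleton[of "(a + b) / 2"] by eventually_elim auto
    qed auto
    moreover have "emeasure lborel (C \<inter> {..(a + b) / 2}) + emeasure lborel (C \<inter> {(a + b) / 2<..}) = emeasure lborel C"
      by (subst plus_emeasure) (auto intro!: arg_cong[of _ _ "emeasure lborel"])
    ultimately show ?thesis by (metis add_mono distrib_left)
  qed
  have step: "emeasure lborel A + emeasure lborel (B \<inter> {b..}) \<le> 2 * emeasure lborel C" if "b \<in> B" for b
    by (rule emeasure_le_initial_segments[OF assms(1) ne(1)]) (rule key[OF _ that])
  \<comment> \<open>Exhaustion works from below, so \<open>B\<close> is reflected to turn its final
    segments into initial ones.\<close>
  let ?B = "uminus -` B"
  have "emeasure lborel (?B \<inter> {..b}) + emeasure lborel A \<le> 2 * emeasure lborel C" if b: "b \<in> ?B" for b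
  proof -
    have "emeasure lborel (?B \<inter> {..b}) = emeasure lborel (uminus -` (B \<inter> {-b..}))"
      by (rule arg_cong[of _ _ "emeasure lborel"]) auto
    also have "\<dots> = emeasure lborel (B \<inter> {-b..})" by (rule emeasure_uminus_vimage) measurable
    finally show ?thesis using step[of "- b"] b by (simp add: add.commute)
  qed
  moreover obtain b where "b \<in> B" using ne(2) by auto
  then have "- b \<in> ?B" by simp
  then have "?B \<noteq> {}" by blast
  moreover have "?B \<in> sets borel" using measurable_sets[of uminus borel borel B] by simp
  ultimately have "emeasure lborel ?B + emeasure lborel A \<le> 2 * emeasure lborel C"
    by (intro emeasure_le_initial_segments[of ?B]) blast+
  then show ?thesis by (simp add: emeasure_uminus_vimage add.commute)
qed

section \<open>The Prekopa-Leindler inequality on the line\<close>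

lemma nn_integral_level_sets:
  fixes f :: "real \<Rightarrow> ennreal"
  assumes [measurable]: "f \<in> borel_measurable borel"
  shows "(\<integral>\<^sup>+x. emeasure lborel {t\<in>{0<..<1}. ennreal t < f x} \<partial>lborel)
    = (\<integral>\<^sup>+t. indicator {0<..<1} t * emeasure lborel {x. ennreal t < f x} \<partial>lborel)"
proof -
  have "(\<integral>\<^sup>+x. emeasure lborel {t\<in>{0<..<1}. ennreal t < f x} \<partial>lborel)
      = (\<integral>\<^sup>+x. (\<integral>\<^sup>+t. indicator {0<..<1} t * indicator {t. ennreal t < f x} t \<partial>lborel) \<partial>lborel)"
  proof (rule nn_integral_cong)
    fix x
    have "emeasure lborel {t\<in>{0<..<1}. ennreal t < f x} = (\<integral>\<^sup>+t. indicator {t\<in>{0<..<1}. ennreal t < f x} t \<partial>lborel)"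
      by (rule nn_integral_indicator[symmetric]) measurable
    also have "\<dots> = (\<integral>\<^sup>+t. indicator {0<..<1} t * indicator {t. ennreal t < f x} t \<partial>lborel)"
      by (intro nn_integral_cong) (auto simp: indicator_def)
    finally show "emeasure lborel {t\<in>{0<..<1}. ennreal t < f x}
      = (\<integral>\<^sup>+t. indicator {0<..<1} t * indicator {t. ennreal t < f x} t \<partial>lborel)" .
  qed
  also have "\<dots> = (\<integral>\<^sup>+t. (\<integral>\<^sup>+x. indicator {0<..<1} t * indicator {t. ennreal t < f x} t \<partial>lborel) \<partial>lborel)"
    by (rule lborel_pair.Fubini'[symmetric]) (simp add: indicator_def, measurable)
  also have "\<dots> = (\<integral>\<^sup>+t. indicator {0<..<1} t * emeasure lborel {x. ennreal t < f x} \<partial>lborel)"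
  proof (intro nn_integral_cong)
    fix t :: real
    have "(\<integral>\<^sup>+x. indicator {0<..<1} t * indicator {t. ennreal t < f x} t \<partial>lborel)
      = indicator {0<..<1} t * (\<integral>\<^sup>+x. indicator {x. ennreal t < f x} x \<partial>lborel)"
      by (subst nn_integral_cmult[symmetric]) (auto intro!: nn_integral_cong simp: indicator_def)
    then show "(\<integral>\<^sup>+x. indicator {0<..<1} t * indicator {t. ennreal t < f x} t \<partial>lborel)
      = indicator {0<..<1} t * emeasure lborel {x. ennreal t < f x}"
      by simp
  qed
  finally show ?thesis .
qed

text \<open>Levels above 1 are cut off, hence only an inequality. It is the direction required for
  \<open>h\<close>, which may exceed 1.\<close>

lemma emeasure_levels_le: "emeasure lborel {t\<in>{0<..<1}. ennreal t < u} \<le> u"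
proof (cases u)
  case (real r)
  then have "emeasure lborel {t\<in>{0<..<1}. ennreal t < u} \<le> emeasure lborel {0..r}"
    by (intro emeasure_mono) (auto simp: ennreal_less_iff)
  then show ?thesis using real by simp
qed simp

lemma emeasure_levels_eq:
  assumes "0 \<le> r" "r \<le> 1"
  shows "emeasure lborel {t\<in>{0<..<1}. ennreal t < ennreal r} = ennreal r"
proof -
  have "{t\<in>{0<..<1}. ennreal t < ennreal r} = {0<..<r}"
    using assms by (auto simp: ennreal_less_iff)
  then show ?thesis using assms by simp
qed

text \<open>With both suprema equal to 1, the level sets of \<open>f\<close> and \<open>g\<close>
  are nonempty for the same levels t < 1, as Brunn-Minkowski demands. Integrating over the levels
  gives an additive conclusion, stronger than the product form.\<close>

lemma prekopa_leindler_normalized: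
  fixes f g :: "real \<Rightarrow> real" and h :: "real \<Rightarrow> ennreal"
  assumes [measurable]: "f \<in> borel_measurable borel" "g \<in> borel_measurable borel" "h \<in> borel_measurable borel"
    and f: "\<And>x. 0 \<le> f x" "\<And>x. f x \<le> 1" "\<And>t. t < 1 \<Longrightarrow> \<exists>x. t < f x"
    and g: "\<And>x. 0 \<le> g x" "\<And>x. g x \<le> 1" "\<And>t. t < 1 \<Longrightarrow> \<exists>x. t < g x"
    and fgh: "\<And>x y. ennreal (f x * g y) \<le> (h ((x + y) / 2))\<^sup>2"
  shows "(\<integral>\<^sup>+x. f x \<partial>lborel) + (\<integral>\<^sup>+x. g x \<partial>lborel) \<le> 2 * (\<integral>\<^sup>+x. h x \<partial>lborel)"
proof -
  have level: "emeasure lborel {x. ennreal t < f x} + emeasure lborel {x. ennreal t < g x}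
      \<le> 2 * emeasure lborel {x. ennreal t < h x}" if t: "0 < t" "t < 1" for t
  proof (rule brunn_minkowski_midpoint_real)
    fix a b assume "a \<in> {x. ennreal t < f x}" "b \<in> {x. ennreal t < g x}"
    then have ab: "t < f a" "t < g b" using t by (auto simp: ennreal_less_iff)
    show "(a + b) / 2 \<in> {x. ennreal t < h x}"
    proof (rule ccontr)
      assume "(a + b) / 2 \<notin> {x. ennreal t < h x}"
      then have "h ((a + b) / 2) \<le> ennreal t" by (simp add: not_less)
      then have "(h ((a + b) / 2))\<^sup>2 \<le> (ennreal t)\<^sup>2" by (rule power_mono) simp
      with fgh[of a b] have "ennreal (f a * g b) \<le> ennreal (t * t)"
        using t by (simp add: power2_eq_square ennreal_mult')
      moreover have "t * t < f a * g b" using ab t by (intro mult_strict_mono) auto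
      ultimately show False using t by (simp add: ennreal_le_iff)
    qed
  qed (use t f(3)[of t] g(3)[of t] in \<open>auto simp: ennreal_less_iff\<close>)
  have "(\<integral>\<^sup>+x. f x \<partial>lborel) + (\<integral>\<^sup>+x. g x \<partial>lborel) =
      (\<integral>\<^sup>+x. emeasure lborel {t\<in>{0<..<1}. ennreal t < f x} \<partial>lborel)
    + (\<integral>\<^sup>+x. emeasure lborel {t\<in>{0<..<1}. ennreal t < g x} \<partial>lborel)"
    using f g by (simp only: emeasure_levels_eq)
  also have "\<dots> = (\<integral>\<^sup>+t. indicator {0<..<1} t * emeasure lborel {x. ennreal t < f x} \<partial>lborel)
      + (\<integral>\<^sup>+t. indicator {0<..<1} t * emeasure lborel {x. ennreal t < g x} \<partial>lborel)"
    by (subst (1 2) nn_integral_level_sets) auto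
  also have "\<dots> = (\<integral>\<^sup>+t. indicator {0<..<1} t * emeasure lborel {x. ennreal t < f x}
      + indicator {0<..<1} t * emeasure lborel {x. ennreal t < g x} \<partial>lborel)"
    by (rule nn_integral_add[symmetric]) measurable
  also have "\<dots> \<le> (\<integral>\<^sup>+t. 2 * (indicator {0<..<1} t * emeasure lborel {x. ennreal t < h x}) \<partial>lborel)"
    using level by (intro nn_integral_mono) (auto simp: indicator_def)
  also have "\<dots> = 2 * (\<integral>\<^sup>+t. indicator {0<..<1} t * emeasure lborel {x. ennreal t < h x} \<partial>lborel)"
    by (rule nn_integral_cmult) measurable
  also have "\<dots> = 2 * (\<integral>\<^sup>+x. emeasure lborel {t\<in>{0<..<1}. ennreal t < h x} \<partial>lborel)"
    by (subst nn_integral_level_sets) auto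
  also have "\<dots> \<le> 2 * (\<integral>\<^sup>+x. h x \<partial>lborel)"
    by (intro mult_left_mono nn_integral_mono emeasure_levels_le) auto
  finally show ?thesis .
qed

lemma ennreal_mult_le_square:
  fixes a b c :: ennreal
  assumes "a + b \<le> 2 * c"
  shows "a * b \<le> c\<^sup>2"
proof (cases c)
  case (real z)
  then have "a + b \<le> ennreal (2 * z)" using assms by (simp add: ennreal_mult')
  then have "a + b < top" using ennreal_less_top le_less_trans by blast
  then obtain x y where xy: "a = ennreal x" "0 \<le> x" "b = ennreal y" "0 \<le> y"
    by (cases a; cases b) auto
  have "ennreal (x + y) \<le> ennreal (2 * z)" using assms xy real by (simp add: ennreal_mult')
  then have "x + y \<le> 2 * z" using real by (simp add: ennreal_le_iff)
  then have "(x + y)\<^sup>2 \<le> (2 * z)\<^sup>2" using xy by (intro power_mono) auto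
  moreover have "0 \<le> (x - y)\<^sup>2" by simp
  ultimately have "x * y \<le> z\<^sup>2" by (simp add: power2_eq_square algebra_simps)
  then have "ennreal (x * y) \<le> ennreal (z\<^sup>2)" by (rule ennreal_leI)
  then show ?thesis using xy real by (simp add: ennreal_mult ennreal_power)
qed simp

text \<open>Dividing \<open>f\<close> and \<open>g\<close> by their suprema and \<open>h\<close> by
  the geometric mean of these keeps the hypothesis. The arithmetic-geometric mean inequality turns
  the normalized sum into a product, which scales back.\<close>

lemma prekopa_leindler_bounded:
  fixes f g :: "real \<Rightarrow> real" and h :: "real \<Rightarrow> ennreal"
  assumes [measurable]: "f \<in> borel_measurable borel" "g \<in> borel_measurable borel" "h \<in> borel_measurable borel"
    and f: "\<And>x. 0 \<le> f x" "\<And>x. f x \<le> L" and g: "\<And>x. 0 \<le> g x" "\<And>x. g x \<le> L"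
    and fgh: "\<And>x y. ennreal (f x * g y) \<le> (h ((x + y) / 2))\<^sup>2"
  shows "(\<integral>\<^sup>+x. f x \<partial>lborel) * (\<integral>\<^sup>+x. g x \<partial>lborel) \<le> (\<integral>\<^sup>+x. h x \<partial>lborel)\<^sup>2"
proof (cases "(\<forall>x. f x = 0) \<or> (\<forall>x. g x = 0)")
  case False
  define m where "m = (SUP x. f x)"
  define l where "l = (SUP x. g x)"
  have bdd: "bdd_above (range f)" "bdd_above (range g)" using f g by (auto intro!: bdd_aboveI[of _ L])
  have le: "f x \<le> m" "g x \<le> l" for x unfolding m_def l_def using bdd by (auto intro: cSUP_upper)
  obtain x y where "f x > 0" "g y > 0" using False f(1) g(1) by (metis less_eq_real_def)
  then have pos: "m > 0" "l > 0" using le[of x] le[of y] by linarith+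
  define r where "r = sqrt (m * l)"
  have r: "r > 0" "r * r = m * l" using pos by (auto simp: r_def)
  let ?h = "\<lambda>x. ennreal (1 / r) * h x"
  have "(\<integral>\<^sup>+x. f x / m \<partial>lborel) + (\<integral>\<^sup>+x. g x / l \<partial>lborel) \<le> 2 * (\<integral>\<^sup>+x. ?h x \<partial>lborel)"
  proof (rule prekopa_leindler_normalized)
    show "\<exists>x. t < f x / m" if "t < 1" for t
      using less_cSUP_iff[of UNIV f "t * m"] bdd that pos by (auto simp: m_def[symmetric] field_simps)
    show "\<exists>x. t < g x / l" if "t < 1" for t
      using less_cSUP_iff[of UNIV g "t * l"] bdd that pos by (auto simp: l_def[symmetric] field_simps)
    fix x y
    have "ennreal (f x / m * (g y / l)) = ennreal (1 / r) * ennreal (1 / r) * ennreal (f x * g y)"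
      using r f g pos by (simp flip: ennreal_mult' ennreal_mult'')
    also have "\<dots> \<le> ennreal (1 / r) * ennreal (1 / r) * (h ((x + y) / 2))\<^sup>2"
      using fgh by (intro mult_left_mono) auto
    also have "\<dots> = (?h ((x + y) / 2))\<^sup>2" by (simp add: power2_eq_square mult_ac)
    finally show "ennreal (f x / m * (g y / l)) \<le> (?h ((x + y) / 2))\<^sup>2" .
  qed (use f g le pos in auto)
  then have "(\<integral>\<^sup>+x. f x / m \<partial>lborel) * (\<integral>\<^sup>+x. g x / l \<partial>lborel) \<le> (\<integral>\<^sup>+x. ?h x \<partial>lborel)\<^sup>2"
    by (rule ennreal_mult_le_square)
  then have "ennreal (m * l) * ((\<integral>\<^sup>+x. f x / m \<partial>lborel) * (\<integral>\<^sup>+x. g x / l \<partial>lborel))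
    \<le> ennreal (r * r) * (\<integral>\<^sup>+x. ?h x \<partial>lborel)\<^sup>2"
    unfolding r by (rule mult_left_mono) simp
  also have "ennreal (m * l) * ((\<integral>\<^sup>+x. f x / m \<partial>lborel) * (\<integral>\<^sup>+x. g x / l \<partial>lborel))
     = (ennreal m * (\<integral>\<^sup>+x. f x / m \<partial>lborel)) * (ennreal l * (\<integral>\<^sup>+x. g x / l \<partial>lborel))"
    using pos by (simp add: ennreal_mult' mult_ac)
  also have "ennreal m * (\<integral>\<^sup>+x. f x / m \<partial>lborel) = (\<integral>\<^sup>+x. f x \<partial>lborel)"
    using pos by (subst nn_integral_cmult[symmetric]) (auto simp flip: ennreal_mult')
  also have "ennreal l * (\<integral>\<^sup>+x. g x / l \<partial>lborel) = (\<integral>\<^sup>+x. g x \<partial>lborel)"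
    using pos by (subst nn_integral_cmult[symmetric]) (auto simp flip: ennreal_mult')
  also have "ennreal (r * r) * (\<integral>\<^sup>+x. ?h x \<partial>lborel)\<^sup>2 = (ennreal r * (\<integral>\<^sup>+x. ?h x \<partial>lborel))\<^sup>2"
    using r(1) by (simp add: ennreal_mult' power2_eq_square mult_ac)
  also have "ennreal r * (\<integral>\<^sup>+x. ?h x \<partial>lborel) = (\<integral>\<^sup>+x. ennreal r * ?h x \<partial>lborel)"
    by (rule nn_integral_cmult[symmetric]) auto
  also have "\<dots> = (\<integral>\<^sup>+x. h x \<partial>lborel)"
    using r(1) by (intro nn_integral_cong) (simp flip: ennreal_mult' mult.assoc)
  finally show ?thesis .
qed auto

lemma nn_integral_truncate:
  assumes [measurable]: "f \<in> borel_measurable M"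
  shows "(\<integral>\<^sup>+x. f x \<partial>M) = (SUP k::nat. \<integral>\<^sup>+x. ennreal (enn2real (min (f x) (of_nat k))) \<partial>M)"
proof -
  have eq: "ennreal (enn2real (min u (of_nat k))) = min u (of_nat k)" for u :: ennreal and k :: nat
    by (rule ennreal_enn2real) (simp add: min_less_iff_disj ennreal_of_nat_eq_real_of_nat)
  have "(SUP k::nat. min u (of_nat k)) = u" for u :: ennreal
  proof -
    have "(SUP k::nat. min u (of_nat k)) = min u (SUP k::nat. of_nat k)"
      by (simp add: inf_min[symmetric] inf_SUP)
    then show ?thesis by (simp add: ennreal_SUP_of_nat_eq_top)
  qed
  then have "(\<integral>\<^sup>+x. f x \<partial>M) = (\<integral>\<^sup>+x. (SUP k::nat. min (f x) (of_nat k)) \<partial>M)" by simp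
  also have "\<dots> = (SUP k::nat. \<integral>\<^sup>+x. min (f x) (of_nat k) \<partial>M)"
    by (rule nn_integral_monotone_convergence_SUP)
       (auto simp: incseq_def le_fun_def intro: min.coboundedI2)
  finally show ?thesis by (simp add: eq)
qed

text \<open>In the induction over the dimension the functions are marginals, which may be unbounded
  or infinite, so \<open>f\<close> and \<open>g\<close> are truncated. Independent truncation levels
  \<open>j\<close> and \<open>k\<close> let the two suprema be taken separately.\<close>

lemma prekopa_leindler_real:
  fixes f g h :: "real \<Rightarrow> ennreal"
  assumes [measurable]: "f \<in> borel_measurable borel" "g \<in> borel_measurable borel" "h \<in> borel_measurable borel"
    and fgh: "\<And>x y. f x * g y \<le> (h ((x + y) / 2))\<^sup>2"
  shows "(\<integral>\<^sup>+x. f x \<partial>lborel) * (\<integral>\<^sup>+x. g x \<partial>lborel) \<le> (\<integral>\<^sup>+x. h x \<partial>lborel)\<^sup>2"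
proof -
  define T where "T u k = enn2real (min u (of_nat k))" for u :: ennreal and k :: nat
  have eq: "ennreal (T u k) = min u (of_nat k)" for u k
    unfolding T_def by (rule ennreal_enn2real) (simp add: min_less_iff_disj ennreal_of_nat_eq_real_of_nat)
  have T: "0 \<le> T u k" "T u k \<le> real k" for u k
  proof -
    show "0 \<le> T u k" by (simp add: T_def)
    have "ennreal (T u k) \<le> ennreal (real k)" unfolding eq by (simp add: ennreal_of_nat_eq_real_of_nat)
    then show "T u k \<le> real k" by (simp add: ennreal_le_iff)
  qed
  have [measurable]: "(\<lambda>x. T (f x) k) \<in> borel_measurable borel" "(\<lambda>x. T (g x) k) \<in> borel_measurable borel" for k
    unfolding T_def by measurable
  have "(\<integral>\<^sup>+x. T (f x) j \<partial>lborel) * (\<integral>\<^sup>+x. T (g x) k \<partial>lborel) \<le> (\<integral>\<^sup>+x. h x \<partial>lborel)\<^sup>2" for j k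
  proof (rule prekopa_leindler_bounded[where L = "real (max j k)"])
    fix x y
    have "ennreal (T (f x) j * T (g y) k) = min (f x) (of_nat j) * min (g y) (of_nat k)"
      using T by (simp add: ennreal_mult eq)
    also have "\<dots> \<le> f x * g y" by (intro mult_mono) auto
    finally show "ennreal (T (f x) j * T (g y) k) \<le> (h ((x + y) / 2))\<^sup>2" using fgh order_trans by blast
    show "T (f x) j \<le> real (max j k)" "T (g x) k \<le> real (max j k)"
      using T(2)[of "f x" j] T(2)[of "g x" k] by auto
  qed (use T in auto)
  then show ?thesis
    using nn_integral_truncate[of f lborel] nn_integral_truncate[of g lborel]
    by (simp add: T_def[symmetric] SUP_mult_right_ennreal SUP_mult_left_ennreal SUP_le_iff)
qed

section \<open>Slicing off the last coordinate, and Prekopa-Leindler in dimension n\<close>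

lemma measurable_slice:
  fixes u :: "point \<Rightarrow> ennreal"
  assumes "u \<in> borel_measurable (Rn_lborel (Suc n))"
  shows "(\<lambda>x. u (x(n := s))) \<in> borel_measurable (Rn_lborel n)"
proof -
  have "(\<lambda>x. x(n := s)) \<in> measurable (Rn_lborel n) (Rn_lborel (Suc n))"
    unfolding Rn_lborel_def by (rule measurable_fun_upd[where J = "{..<n}"]) auto
  then show ?thesis using assms by (rule measurable_compose)
qed

lemma measurable_marginal:
  fixes u :: "point \<Rightarrow> ennreal"
  assumes "u \<in> borel_measurable (Rn_lborel (Suc n))"
  shows "(\<lambda>s. \<integral>\<^sup>+x. u (x(n := s)) \<partial>Rn_lborel n) \<in> borel_measurable borel"
proof -
  interpret product_sigma_finite "\<lambda>_::nat. lborel :: real measure" by standard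
  interpret R: sigma_finite_measure "Rn_lborel n"
    unfolding Rn_lborel_def by (rule sigma_finite) simp
  have upd: "(\<lambda>(s, x). x(n := s)) \<in> measurable (borel \<Otimes>\<^sub>M Rn_lborel n) (Rn_lborel (Suc n))"
    unfolding Rn_lborel_def split_beta by (rule measurable_fun_upd[where J = "{..<n}"]) auto
  show ?thesis
    by (rule R.borel_measurable_nn_integral) (use measurable_compose[OF upd assms] in \<open>simp add: split_beta'\<close>)
qed

lemma nn_integral_Rn_lborel_Suc:
  assumes "u \<in> borel_measurable (Rn_lborel (Suc n))"
  shows "(\<integral>\<^sup>+x. u x \<partial>Rn_lborel (Suc n)) = (\<integral>\<^sup>+s. (\<integral>\<^sup>+x. u (x(n := s)) \<partial>Rn_lborel n) \<partial>lborel)"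
proof -
  interpret product_sigma_finite "\<lambda>_::nat. lborel :: real measure" by standard
  have ins: "Rn_lborel (Suc n) = (\<Pi>\<^sub>M i\<in>insert n {..<n}. lborel)"
    by (simp add: Rn_lborel_def lessThan_Suc)
  show ?thesis
    using assms unfolding ins by (subst product_nn_integral_insert_rev) (auto simp: Rn_lborel_def)
qed

lemma nn_integral_Rn_lborel_0: "(\<integral>\<^sup>+x. u x \<partial>Rn_lborel 0) = u (\<lambda>_. undefined)"
proof -
  interpret product_sigma_finite "\<lambda>_::nat. lborel :: real measure" by standard
  show ?thesis by (simp add: Rn_lborel_def nn_integral_empty)
qed

lemma fun_upd_in_space_Rn:
  "x \<in> space (Rn_lborel n) \<Longrightarrow> x(n := s) \<in> space (Rn_lborel (Suc n))"
  by (auto simp: Rn_lborel_def space_PiM PiE_def extensional_def)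

text \<open>For fixed last coordinates \<open>s\<close> and \<open>t\<close> the slices satisfy the
  hypothesis in dimension \<open>n\<close>. The induction hypothesis then has the form of the
  one-dimensional hypothesis for the marginals, which is why hypothesis and conclusion share the
  squared form.\<close>

lemma prekopa_leindler_midpoint:
  fixes f g h :: "point \<Rightarrow> ennreal"
  assumes "f \<in> borel_measurable (Rn_lborel n)" "g \<in> borel_measurable (Rn_lborel n)"
      "h \<in> borel_measurable (Rn_lborel n)"
    and "\<And>x y. x \<in> space (Rn_lborel n) \<Longrightarrow> y \<in> space (Rn_lborel n) \<Longrightarrow>
      f x * g y \<le> (h (\<lambda>i\<in>{..<n}. (x i + y i) / 2))\<^sup>2"
  shows "(\<integral>\<^sup>+x. f x \<partial>Rn_lborel n) * (\<integral>\<^sup>+x. g x \<partial>Rn_lborel n) \<le> (\<integral>\<^sup>+x. h x \<partial>Rn_lborel n)\<^sup>2"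
  using assms
proof (induction n arbitrary: f g h)
  case 0
  show ?case using 0(4)[of "\<lambda>k. undefined" "\<lambda>k. undefined"]
    by (simp add: nn_integral_Rn_lborel_0) (simp add: Rn_lborel_def space_PiM)
next
  case (Suc n)
  show ?case unfolding Suc.prems(1-3)[THEN nn_integral_Rn_lborel_Suc]
  proof (rule prekopa_leindler_real)
    fix s t :: real
    show "(\<integral>\<^sup>+x. f (x(n := s)) \<partial>Rn_lborel n) * (\<integral>\<^sup>+x. g (x(n := t)) \<partial>Rn_lborel n)
      \<le> (\<integral>\<^sup>+x. h (x(n := (s + t) / 2)) \<partial>Rn_lborel n)\<^sup>2"
    proof (rule Suc.IH)
      fix x y assume xy: "x \<in> space (Rn_lborel n)" "y \<in> space (Rn_lborel n)"
      have "x(n := s) \<in> space (Rn_lborel (Suc n))" "y(n := t) \<in> space (Rn_lborel (Suc n))"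
        by (intro fun_upd_in_space_Rn xy)+
      note Suc.prems(4)[OF this]
      also have "(\<lambda>i\<in>{..<Suc n}. ((x(n := s)) i + (y(n := t)) i) / 2)
        = (\<lambda>i\<in>{..<n}. (x i + y i) / 2)(n := (s + t) / 2)"
        by (auto simp: fun_eq_iff restrict_def less_Suc_eq)
      finally show "f (x(n := s)) * g (y(n := t)) \<le> (h ((\<lambda>i\<in>{..<n}. (x i + y i) / 2)(n := (s + t) / 2)))\<^sup>2" .
    qed (intro measurable_slice Suc.prems)+
  qed (intro measurable_marginal Suc.prems)+
qed

section \<open>Volume under homotheties\<close>

lemma nn_integral_Rn_affine:
  fixes u :: "point \<Rightarrow> ennreal"
  assumes "u \<in> borel_measurable (Rn_lborel n)" "c > 0"
  shows "(\<integral>\<^sup>+x. u x \<partial>Rn_lborel n) = ennreal (c ^ n) * (\<integral>\<^sup>+x. u (\<lambda>i\<in>{..<n}. t i + c * x i) \<partial>Rn_lborel n)"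
  using assms
proof (induction n arbitrary: u)
  case 0
  show ?case by (simp only: nn_integral_Rn_lborel_0) (simp add: restrict_def)
next
  case (Suc n)
  have aff: "(\<lambda>x. \<lambda>i\<in>{..<m}. t i + c * x i) \<in> measurable (Rn_lborel m) (Rn_lborel m)" for m
    unfolding Rn_lborel_def by (rule measurable_restrict) measurable
  have eq: "(\<lambda>i\<in>{..<Suc n}. t i + c * (x(n := s)) i) = (\<lambda>i\<in>{..<n}. t i + c * x i)(n := t n + c * s)" for x s
    by (auto simp: fun_eq_iff restrict_def less_Suc_eq)
  have "(\<integral>\<^sup>+x. u x \<partial>Rn_lborel (Suc n)) = (\<integral>\<^sup>+s. (\<integral>\<^sup>+x. u (x(n := s)) \<partial>Rn_lborel n) \<partial>lborel)"
    by (rule nn_integral_Rn_lborel_Suc) fact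
  also have "\<dots> = ennreal \<bar>c\<bar> * (\<integral>\<^sup>+s. (\<integral>\<^sup>+x. u (x(n := t n + c * s)) \<partial>Rn_lborel n) \<partial>lborel)"
    using Suc.prems by (intro nn_integral_real_affine measurable_marginal) auto
  also have "(\<integral>\<^sup>+s. (\<integral>\<^sup>+x. u (x(n := t n + c * s)) \<partial>Rn_lborel n) \<partial>lborel)
    = (\<integral>\<^sup>+s. ennreal (c ^ n) * (\<integral>\<^sup>+x. u (\<lambda>i\<in>{..<Suc n}. t i + c * (x(n := s)) i) \<partial>Rn_lborel n) \<partial>lborel)"
    unfolding eq by (intro nn_integral_cong Suc.IH measurable_slice Suc.prems)
  also have "\<dots> = ennreal (c ^ n) * (\<integral>\<^sup>+s. (\<integral>\<^sup>+x. u (\<lambda>i\<in>{..<Suc n}. t i + c * (x(n := s)) i) \<partial>Rn_lborel n) \<partial>lborel)"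
    using measurable_marginal[OF measurable_compose[OF aff Suc.prems(1)]]
    by (intro nn_integral_cmult) (simp only: measurable_lborel2)
  also have "(\<integral>\<^sup>+s. (\<integral>\<^sup>+x. u (\<lambda>i\<in>{..<Suc n}. t i + c * (x(n := s)) i) \<partial>Rn_lborel n) \<partial>lborel)
    = (\<integral>\<^sup>+x. u (\<lambda>i\<in>{..<Suc n}. t i + c * x i) \<partial>Rn_lborel (Suc n))"
    by (rule nn_integral_Rn_lborel_Suc[symmetric]) (rule measurable_compose[OF aff Suc.prems(1)])
  also have "ennreal \<bar>c\<bar> * (ennreal (c ^ n) * X) = ennreal (c ^ Suc n) * X" for X
    using Suc.prems by (simp add: ennreal_mult' mult.assoc)
  finally show ?case .
qed

lemma emeasure_Rn_affine_le:
  assumes "A \<in> sets (Rn_lborel n)" "B \<in> sets (Rn_lborel n)" "c > 0"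
    and "\<And>x. x \<in> A \<Longrightarrow> (\<lambda>i\<in>{..<n}. t i + c * x i) \<in> B"
  shows "ennreal (c ^ n) * emeasure (Rn_lborel n) A \<le> emeasure (Rn_lborel n) B"
proof -
  have "ennreal (c ^ n) * emeasure (Rn_lborel n) A = ennreal (c ^ n) * (\<integral>\<^sup>+x. indicator A x \<partial>Rn_lborel n)"
    using assms by simp
  also have "\<dots> \<le> ennreal (c ^ n) * (\<integral>\<^sup>+x. indicator B (\<lambda>i\<in>{..<n}. t i + c * x i) \<partial>Rn_lborel n)"
    using assms(4) by (intro mult_left_mono nn_integral_mono) (auto simp: indicator_def)
  also have "\<dots> = (\<integral>\<^sup>+x. indicator B x \<partial>Rn_lborel n)"
    using assms by (intro nn_integral_Rn_affine[symmetric]) auto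
  finally show ?thesis using assms by simp
qed

section \<open>Log-concave tails\<close>

text \<open>The multiples of \<open>u\<close> from 0 up to \<open>y\<close> number floor(y/u) + 1,
  so \<open>u\<close> times their number is at least \<open>y\<close>. Taking expectations bounds
  the positive part by a sum of tails.\<close>

lemma le_sum_levels:
  fixes y u :: real
  assumes "u > 0" "0 \<le> y" "y \<le> real k * u"
  shows "y \<le> (\<Sum>j<k. u * of_bool (real j * u \<le> y))"
  using assms(3)
proof (induction k)
  case 0
  then show ?case using assms by simp
next
  case (Suc k)
  show ?case
  proof (cases "real k * u \<le> y")
    case True
    have "real j * u \<le> y" if "j < Suc k" for j
    proof -
      have "real j * u \<le> real k * u" using that assms by (intro mult_right_mono) auto
      then show ?thesis using True by linarith
    qed
    then have "(\<Sum>j<Suc k. u * of_bool (real j * u \<le> y)) = (\<Sum>j<Suc k. u)"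
      by (intro sum.cong) auto
    then show ?thesis using Suc.prems by (simp add: algebra_simps)
  next
    case False
    then show ?thesis using Suc.IH by simp
  qed
qed

context prob_space
begin

text \<open>Supplies the unit of length for the tail estimate. If no such \<open>u\<close> existed,
  mass 1/2 would persist under repeated halving of the threshold, starting from a bound on |f|, and
  would reach threshold 0 in the limit.\<close>

lemma half_mass_threshold:
  fixes f :: "'a \<Rightarrow> real"
  assumes [measurable]: "f \<in> borel_measurable M" and bdd: "AE x in M. \<bar>f x\<bar> \<le> L"
    and small: "prob {x \<in> space M. 0 \<le> f x} < 1 / 2"
  shows "\<exists>u>0. prob {x \<in> space M. - u \<le> f x} \<ge> 1 / 2 \<and> prob {x \<in> space M. - u / 2 \<le> f x} < 1 / 2"
proof (rule ccontr)
  assume no: "\<not> ?thesis"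
  define \<phi> where "\<phi> s = prob {x \<in> space M. s \<le> f x}" for s
  define L' where "L' = max L 1"
  have pos: "L' > 0" by (simp add: L'_def)
  have ge: "\<phi> (- L' / 2 ^ k) \<ge> 1 / 2" for k
  proof (induction k)
    case 0
    have "AE x in M. x \<in> {x \<in> space M. - L' \<le> f x}"
      using bdd AE_space by eventually_elim (auto simp: L'_def)
    then have "\<phi> (- L') = 1" unfolding \<phi>_def by (subst prob_eq_1) auto
    then show ?case by simp
  next
    case (Suc k)
    have "L' / 2 ^ k > 0" by (simp add: L'_def)
    then show ?case using no Suc unfolding \<phi>_def by (auto simp: not_less field_simps dest!: spec[of _ "L' / 2 ^ k"])
  qed
  have "(\<lambda>k. \<phi> (- L' / 2 ^ k)) \<longlonglongrightarrow> prob (\<Inter>k. {x \<in> space M. - L' / 2 ^ k \<le> f x})"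
    unfolding \<phi>_def
  proof (rule finite_Lim_measure_decseq)
    show "decseq (\<lambda>k. {x \<in> space M. - L' / 2 ^ k \<le> f x})"
    proof (rule decseq_SucI, clarify)
      fix k x assume "- L' / 2 ^ Suc k \<le> f x"
      moreover have "L' / 2 ^ Suc k \<le> L' / 2 ^ k" using pos by (simp add: field_simps)
      ultimately show "- L' / 2 ^ k \<le> f x" by simp
    qed
  qed auto
  moreover have "(\<Inter>k. {x \<in> space M. - L' / 2 ^ k \<le> f x}) = {x \<in> space M. 0 \<le> f x}"
  proof -
    have "0 \<le> y" if "\<forall>k. - L' / 2 ^ k \<le> y" for y :: real
    proof -
      have "(\<lambda>k. - L' / 2 ^ k) \<longlonglongrightarrow> 0" using LIMSEQ_divide_realpow_zero[of 2 "- L'"] by simp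
      then show ?thesis by (rule LIMSEQ_le_const2) (use that in auto)
    qed
    moreover have "- L' / 2 ^ k \<le> y" if "0 \<le> y" for y :: real and k
    proof -
      have "- L' / 2 ^ k \<le> 0" by (simp add: L'_def)
      then show ?thesis using that by linarith
    qed
    ultimately show ?thesis by auto
  qed
  ultimately have "(\<lambda>k. \<phi> (- L' / 2 ^ k)) \<longlonglongrightarrow> prob {x \<in> space M. 0 \<le> f x}" by simp
  then have "1 / 2 \<le> prob {x \<in> space M. 0 \<le> f x}"
    by (rule LIMSEQ_le_const) (use ge in blast)
  then show False using small by simp
qed

text \<open>With p = P(f \<ge> 0) < 1/6 and P(f \<ge> -u) \<ge> 1/2, the first tail ratio in steps
  of \<open>u\<close> is at most 2p < 1/3, and log-concavity keeps later ratios below it. So the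
  positive part has mean at most u (1/6) / (1 - 1/3) = u/4. The negative part has mean above
  (u/2)(1/2) = u/4, because f < -u/2 with probability above 1/2. The value 1/6 is where the two
  sides balance.\<close>

lemma gruenbaum_log_concave:
  fixes f :: "'a \<Rightarrow> real"
  assumes [measurable]: "f \<in> borel_measurable M" and bdd: "AE x in M. \<bar>f x\<bar> \<le> L"
    and mean: "expectation f = 0"
    and lc: "\<And>a b. prob {x \<in> space M. a \<le> f x} * prob {x \<in> space M. b \<le> f x}
      \<le> (prob {x \<in> space M. (a + b) / 2 \<le> f x})\<^sup>2"
  shows "prob {x \<in> space M. 0 \<le> f x} \<ge> 1 / 6"
proof (rule ccontr)
  define \<phi> where "\<phi> s = prob {x \<in> space M. s \<le> f x}" for s
  define p where "p = \<phi> 0"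
  assume "\<not> ?thesis"
  then have p: "p < 1 / 6" "0 \<le> p" by (auto simp: p_def \<phi>_def)
  obtain u where u: "u > 0" "\<phi> (- u) \<ge> 1 / 2" "\<phi> (- u / 2) < 1 / 2"
    using half_mass_threshold[OF assms(1) bdd] p unfolding p_def \<phi>_def by auto
  have nonneg: "0 \<le> \<phi> s" for s by (simp add: \<phi>_def)
  \<comment> \<open>The subtraction is on the reals: for k = 0 the comparison is with \<phi> (-u),
    which starts the decay.\<close>
  have decay: "\<phi> (real k * u) \<le> 2 * p * \<phi> ((real k - 1) * u)" for k
  proof (induction k)
    case 0
    have "p * (1 / 2) \<le> p * \<phi> (- u)" using u p by (intro mult_left_mono) auto
    then show ?case by (simp add: p_def)
  next
    case (Suc k)
    let ?a = "\<phi> ((real k - 1) * u)" and ?b = "\<phi> (real k * u)" and ?c = "\<phi> (real (Suc k) * u)"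
    have "(real (Suc k) * u + (real k - 1) * u) / 2 = real k * u" by (simp add: field_simps)
    then have "?c * ?a \<le> ?b\<^sup>2" using lc[of "real (Suc k) * u" "(real k - 1) * u"] unfolding \<phi>_def by simp
    also have "\<dots> \<le> ?b * (2 * p * ?a)" unfolding power2_eq_square
      using Suc.IH nonneg by (intro mult_left_mono) auto
    finally have *: "?c * ?a \<le> (2 * p * ?b) * ?a" by (simp add: mult_ac)
    show ?case
    \<comment> \<open>Cancelling \<open>?a\<close> requires it to be nonzero; if it vanishes, the
      later tails vanish by monotonicity.\<close>
    proof (cases "?a = 0")
      case True
      have "?c \<le> ?b" unfolding \<phi>_def
      proof (rule finite_measure_mono)
        have "real k * u \<le> real (Suc k) * u" using u(1) by (intro mult_right_mono) auto
        then show "{x \<in> space M. real (Suc k) * u \<le> f x} \<subseteq> {x \<in> space M. real k * u \<le> f x}" by auto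
      qed auto
      moreover have "?b \<le> 0" using Suc.IH True by simp
      ultimately have "?c \<le> 0" by linarith
      also have "0 \<le> 2 * p * ?b" using p nonneg by simp
      finally show ?thesis by simp
    next
      case False
      then have "?a > 0" using nonneg[of "(real k - 1) * u"] by simp
      then show ?thesis using * by simp
    qed
  qed
  have geo: "\<phi> (real k * u) \<le> (1 / 6) * (1 / 3) ^ k" for k
  proof (induction k)
    case 0
    then show ?case using p by (simp add: p_def)
  next
    case (Suc k)
    have "\<phi> (real (Suc k) * u) \<le> 2 * p * \<phi> (real k * u)" using decay[of "Suc k"] by simp
    also have "\<dots> \<le> (1 / 3) * ((1 / 6) * (1 / 3) ^ k)" using Suc p nonneg by (intro mult_mono) auto
    finally show ?case by simp
  qed
  \<comment> \<open>Levels up to \<open>k\<close> reach beyond the bound \<open>L\<close>, so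
    finitely many of them control the positive part.\<close>
  obtain k where k: "L < real k * u" using reals_Archimedean3[OF u(1)] by blast
  have sum: "(\<Sum>j<k. \<phi> (real j * u)) \<le> 1 / 4"
  proof -
    have "(\<Sum>j<k. \<phi> (real j * u)) \<le> (\<Sum>j<k. (1 / 6) * (1 / 3) ^ j)" by (intro sum_mono geo)
    also have "\<dots> = (1 / 6) * (\<Sum>j<k. (1 / 3) ^ j)" by (simp add: sum_distrib_left)
    also have "\<dots> = (1 / 6) * ((1 - (1 / 3) ^ k) * 3 / 2)" by (simp add: sum_gp_strict)
    also have "\<dots> \<le> 1 / 4" by simp
    finally show ?thesis .
  qed
  \<comment> \<open>A step function above \<open>f\<close>: the levels majorize the positive part,
    values in [-u/2, 0) are replaced by 0, and lower values by -u/2.\<close>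
  define g where "g x = (\<Sum>j<k. u * indicator {x \<in> space M. real j * u \<le> f x} x)
      - u / 2 * indicator {x \<in> space M. f x < - u / 2} x" for x
  have int: "integrable M f" using bdd by (intro integrable_const_bound[where B = L]) auto
  have [measurable]: "{x \<in> space M. s \<le> f x} \<in> sets M" "{x \<in> space M. f x < s} \<in> sets M" for s by auto
  have int2: "integrable M (\<lambda>x. u * indicat_real A x)" if "A \<in> sets M" for A u
    using that by (intro integrable_mult_right integrable_real_indicator) (auto simp: emeasure_eq_measure)
  have intg: "integrable M g" unfolding g_def
    by (intro Bochner_Integration.integrable_diff Bochner_Integration.integrable_sum int2) auto
  have "expectation f \<le> expectation g"
  proof (rule integral_mono_AE[OF int intg])
    show "AE x in M. f x \<le> g x"
      using bdd AE_space
    proof eventually_elim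
      case (elim x)
      have s: "(\<Sum>j<k. u * indicator {x \<in> space M. real j * u \<le> f x} x) = (\<Sum>j<k. u * of_bool (real j * u \<le> f x))"
        using elim by (intro sum.cong) (auto simp: indicator_def)
      show ?case
      proof (cases "0 \<le> f x")
        case True
        then show ?thesis using le_sum_levels[of u "f x" k] elim u(1) k by (auto simp: g_def s)
      next
        case False
        define S where "S = (\<Sum>j<k. u * of_bool (real j * u \<le> f x))"
        have "0 \<le> S" unfolding S_def using u by (intro sum_nonneg) auto
        then show ?thesis using False u(1) elim
          unfolding g_def s S_def[symmetric] by (auto simp: indicator_def)
      qed
    qed
  qed
  also have "expectation g = (\<Sum>j<k. u * \<phi> (real j * u)) - u / 2 * prob {x \<in> space M. f x < - u / 2}"
    unfolding g_def \<phi>_def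
    by (subst Bochner_Integration.integral_diff, intro Bochner_Integration.integrable_sum int2, simp, intro int2, simp,
        subst Bochner_Integration.integral_sum, intro int2, simp, simp)
  also have "prob {x \<in> space M. f x < - u / 2} = 1 - \<phi> (- u / 2)"
    unfolding \<phi>_def by (subst prob_compl[symmetric]) (auto intro!: arg_cong[of _ _ prob])
  finally have "u / 2 * (1 - \<phi> (- u / 2)) \<le> u * (\<Sum>j<k. \<phi> (real j * u))"
    using mean by (simp add: sum_distrib_left)
  also have "\<dots> \<le> u * (1 / 4)" using sum u(1) by (intro mult_left_mono) auto
  also have "\<dots> = u / 2 * (1 / 2)" by simp
  also have "\<dots> < u / 2 * (1 - \<phi> (- u / 2))" using u by (intro mult_strict_left_mono) auto
  finally show False by simp
qed

end

section \<open>Halfspaces meeting a convex body\<close>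

lemma topspace_Rn [simp]: "topspace (Rn_topology n) = {..<n} \<rightarrow>\<^sub>E UNIV"
  by (simp add: Rn_topology_def)

lemma space_Rn_lborel [simp]: "space (Rn_lborel n) = {..<n} \<rightarrow>\<^sub>E UNIV"
  by (simp add: Rn_lborel_def space_PiM)

lemma measurable_coordinate_Rn [measurable]:
  "i < n \<Longrightarrow> (\<lambda>x. x i) \<in> borel_measurable (Rn_lborel n)"
  unfolding Rn_lborel_def using measurable_component_singleton[of i "{..<n}" "\<lambda>_. lborel"] by simp

lemma measurable_ip [measurable]: "(\<lambda>x. ip n x \<theta>) \<in> borel_measurable (Rn_lborel n)"
  unfolding ip_def by (intro borel_measurable_sum borel_measurable_times) auto

lemma ip_restrict_affine:
  "ip n (\<lambda>i\<in>{..<n}. a * x i + b * y i) \<theta> = a * ip n x \<theta> + b * ip n y \<theta>"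
  by (simp add: ip_def sum_distrib_left sum.distrib[symmetric] algebra_simps)

lemma continuous_map_coordinate: "i < n \<Longrightarrow> continuous_map (Rn_topology n) euclideanreal (\<lambda>x. x i)"
  unfolding Rn_topology_def by (rule continuous_map_product_projection) simp

lemma continuous_map_ip: "continuous_map (Rn_topology n) euclideanreal (\<lambda>x. ip n x \<theta>)"
  unfolding ip_def
  by (intro continuous_map_sum continuous_map_real_mult_right continuous_map_coordinate) auto

text \<open>Extension by 0 embeds the extensional functions into the full function type, whose Borel
  sets contain all compact sets. The extension is measurable and injective, so \<open>K\<close> is
  the preimage of its compact image.\<close>

lemma compactin_sets_Rn_lborel:
  assumes "compactin (Rn_topology n) K"
  shows "K \<in> sets (Rn_lborel n)"
proof -
  define e where "e x = (\<lambda>i. if i < n then x i else 0)" for x :: point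
  have "continuous_map (Rn_topology n) euclidean e"
    unfolding euclidean_product_topology[symmetric] continuous_map_componentwise_UNIV e_def
    by (auto intro: continuous_map_coordinate)
  then have "compact (e ` K)" using image_compactin[OF assms, of euclidean e] by simp
  then have [measurable]: "e ` K \<in> sets borel" by (simp add: compact_imp_closed borel_closed)
  have [measurable]: "e \<in> measurable (Rn_lborel n) borel"
    unfolding e_def
  proof (rule measurable_coordinatewise_then_product)
    show "(\<lambda>x. if i < n then x i else 0) \<in> borel_measurable (Rn_lborel n)" for i
      by (cases "i < n") simp_all
  qed
  have K: "K \<subseteq> space (Rn_lborel n)" using compactin_subset_topspace[OF assms] by simp
  have inj: "x = y" if "x \<in> space (Rn_lborel n)" "y \<in> space (Rn_lborel n)" "e x = e y" for x y
  proof
    fix i show "x i = y i"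
      using that(1,2) fun_cong[OF that(3), of i] by (cases "i < n") (auto simp: e_def PiE_def extensional_def)
  qed
  have "K = e -` (e ` K) \<inter> space (Rn_lborel n)" using K inj by blast
  then show ?thesis using measurable_sets[of e "Rn_lborel n" borel "e ` K"] by simp
qed

lemma compactin_Rn_attains_max:
  assumes "compactin (Rn_topology n) K" "K \<noteq> {}"
  shows "\<exists>y\<in>K. \<forall>x\<in>K. ip n x \<theta> \<le> ip n y \<theta>"
proof -
  have "compact ((\<lambda>x. ip n x \<theta>) ` K)"
    using image_compactin[OF assms(1) continuous_map_ip] by simp
  then obtain m where "m \<in> (\<lambda>x. ip n x \<theta>) ` K" "\<forall>t\<in>(\<lambda>x. ip n x \<theta>) ` K. t \<le> m"
    using compact_attains_sup[of "(\<lambda>x. ip n x \<theta>) ` K"] assms(2) by auto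
  then show ?thesis by auto
qed

lemma compactin_Rn_bounded:
  assumes "compactin (Rn_topology n) K"
  shows "\<exists>R. \<forall>x\<in>K. \<forall>i<n. \<bar>x i\<bar> \<le> R"
proof -
  have "\<exists>R. \<forall>x\<in>K. \<bar>x i\<bar> \<le> R" if "i < n" for i
  proof -
    have "compact ((\<lambda>x. x i) ` K)"
      using image_compactin[OF assms continuous_map_coordinate[OF that]] by simp
    then show ?thesis using compact_imp_bounded[of "(\<lambda>x. x i) ` K"] by (auto simp: bounded_iff)
  qed
  then obtain R where R: "\<And>i x. i < n \<Longrightarrow> x \<in> K \<Longrightarrow> \<bar>x i\<bar> \<le> R i" by metis
  have "\<bar>x i\<bar> \<le> (\<Sum>i<n. \<bar>R i\<bar>)" if "x \<in> K" "i < n" for x i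
  proof -
    have "\<bar>x i\<bar> \<le> \<bar>R i\<bar>" using R[OF that(2,1)] by linarith
    also have "\<dots> \<le> (\<Sum>i<n. \<bar>R i\<bar>)" using that by (intro member_le_sum) auto
    finally show ?thesis .
  qed
  then show ?thesis by blast
qed

section \<open>The uniform distribution on a convex body\<close>

context
  fixes n K
  assumes body: "convex_body n K"
begin

lemma body_sets [measurable]: "K \<in> sets (Rn_lborel n)"
  using body by (auto simp: convex_body_def intro: compactin_sets_Rn_lborel)

lemma body_subset: "K \<subseteq> {..<n} \<rightarrow>\<^sub>E UNIV"
  using body by (auto simp: convex_body_def Rn_convex_def)

lemma body_convexD:
  "x \<in> K \<Longrightarrow> y \<in> K \<Longrightarrow> 0 \<le> u \<Longrightarrow> 0 \<le> v \<Longrightarrow> u + v = 1 \<Longrightarrow> (\<lambda>i\<in>{..<n}. u * x i + v * y i) \<in> K"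
  using body by (auto simp: convex_body_def Rn_convex_def)

lemma body_nonempty: "K \<noteq> {}"
  using body interior_of_subset[of "Rn_topology n" K] by (auto simp: convex_body_def)

text \<open>An interior point has an open box around it inside \<open>K\<close>, and compactness
  puts \<open>K\<close> inside a cube.\<close>

lemma body_emeasure: "0 < emeasure (Rn_lborel n) K" "emeasure (Rn_lborel n) K < \<infinity>"
proof -
  interpret finite_product_sigma_finite "\<lambda>_::nat. lborel :: real measure" "{..<n}"
    by standard auto
  obtain x where x: "x \<in> Rn_topology n interior_of K" using body by (auto simp: convex_body_def)
  have "openin (Rn_topology n) (Rn_topology n interior_of K)" by simp
  then obtain U where U: "\<forall>i\<in>{..<n}. open (U i)" "x \<in> Pi\<^sub>E {..<n} U" "Pi\<^sub>E {..<n} U \<subseteq> Rn_topology n interior_of K"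
    using x unfolding Rn_topology_def openin_product_topology_alt by auto
  have "emeasure lborel (U i) > 0" if "i < n" for i
  proof (rule ccontr)
    assume "\<not> ?thesis"
    then have "negligible (U i)" using U(1) that
      by (auto simp: negligible_iff_null_sets null_sets_completion_iff null_sets_def)
    then show False using U that open_not_negligible[of "U i"] by auto
  qed
  then have "0 < (\<Prod>i<n. emeasure lborel (U i))" by (auto simp: zero_less_iff_neq_zero)
  also have "\<dots> = emeasure (Rn_lborel n) (Pi\<^sub>E {..<n} U)"
    unfolding Rn_lborel_def using U by (subst emeasure_PiM) auto
  also have "\<dots> \<le> emeasure (Rn_lborel n) K"
    using U(3) interior_of_subset[of "Rn_topology n" K] by (intro emeasure_mono) auto
  finally show "0 < emeasure (Rn_lborel n) K" .
  obtain R where R: "\<And>x i. x \<in> K \<Longrightarrow> i < n \<Longrightarrow> \<bar>x i\<bar> \<le> R"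
    using compactin_Rn_bounded[of n K] body by (auto simp: convex_body_def)
  have "x \<in> Pi\<^sub>E {..<n} (\<lambda>_. {-R..R})" if "x \<in> K" for x
    using R[OF that] body_subset that by (force simp: PiE_def abs_le_iff)
  then have "emeasure (Rn_lborel n) K \<le> emeasure (Rn_lborel n) (Pi\<^sub>E {..<n} (\<lambda>_. {-R..R}))"
    by (intro emeasure_mono) (auto simp: Rn_lborel_def intro!: sets_PiM_I_finite)
  also have "\<dots> = (\<Prod>i<n. emeasure lborel {-R..R})"
    unfolding Rn_lborel_def by (subst emeasure_PiM) auto
  also have "\<dots> < \<infinity>" using emeasure_compact_finite[of "{-R..R}"]
    by (simp add: less_top[symmetric] power_eq_top_ennreal)
  finally show "emeasure (Rn_lborel n) K < \<infinity>" .
qed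

lemma prob_space_uniform_on: "prob_space (uniform_on n K)"
  unfolding uniform_on_def using body_emeasure by (intro prob_space_uniform_measure) auto

lemma body_emeasure_eq: "emeasure (Rn_lborel n) K = ennreal (measure (Rn_lborel n) K)"
  using body_emeasure by (intro emeasure_eq_ennreal_measure) auto

lemma body_measure_pos: "measure (Rn_lborel n) K > 0"
  using body_emeasure body_emeasure_eq by simp

lemma emeasure_Int_body: "A \<in> sets (Rn_lborel n) \<Longrightarrow>
    emeasure (Rn_lborel n) (K \<inter> A) = ennreal (measure (Rn_lborel n) K * measure (uniform_on n K) A)"
proof -
  assume [measurable]: "A \<in> sets (Rn_lborel n)"
  have "emeasure (Rn_lborel n) (K \<inter> A) \<le> emeasure (Rn_lborel n) K" by (intro emeasure_mono) auto
  then have "emeasure (Rn_lborel n) (K \<inter> A) = ennreal (measure (Rn_lborel n) (K \<inter> A))"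
    using body_emeasure(2) by (intro emeasure_eq_ennreal_measure) (auto simp: top_unique)
  moreover have "measure (uniform_on n K) A = measure (Rn_lborel n) (K \<inter> A) / measure (Rn_lborel n) K"
    unfolding uniform_on_def using body_emeasure by (subst measure_uniform_measure) auto
  ultimately show ?thesis using body_measure_pos by simp
qed

lemma integral_uniform_on:
  fixes f :: "point \<Rightarrow> real"
  assumes [measurable]: "f \<in> borel_measurable (Rn_lborel n)"
  shows "integral\<^sup>L (uniform_on n K) f = (1 / measure (Rn_lborel n) K) * (LINT x:K|Rn_lborel n. f x)"
proof -
  have "uniform_on n K = density (Rn_lborel n) (\<lambda>x. ennreal (indicator K x / measure (Rn_lborel n) K))"
    unfolding uniform_on_def uniform_measure_def body_emeasure_eq
    using body_measure_pos by (intro arg_cong[of _ _ "density (Rn_lborel n)"] ext)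
      (auto simp: indicator_def divide_ennreal[symmetric])
  then have "integral\<^sup>L (uniform_on n K) f = (\<integral>x. (indicator K x / measure (Rn_lborel n) K) *\<^sub>R f x \<partial>Rn_lborel n)"
    using body_measure_pos by (simp add: integral_density)
  also have "\<dots> = (\<integral>x. (1 / measure (Rn_lborel n) K) * (indicator K x *\<^sub>R f x) \<partial>Rn_lborel n)"
    by (intro Bochner_Integration.integral_cong) auto
  finally show ?thesis by (simp add: set_lebesgue_integral_def)
qed

text \<open>Prekopa-Leindler for indicators: by convexity the midpoint of a point of
  \<open>K \<inter> H a\<close> and one of \<open>K \<inter> H b\<close> lies in
  \<open>K \<inter> H ((a + b) / 2)\<close>.\<close>

lemma uniform_on_midpoint_log_concave:
  "measure (uniform_on n K) {x \<in> space (uniform_on n K). a \<le> ip n x \<theta>}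
    * measure (uniform_on n K) {x \<in> space (uniform_on n K). b \<le> ip n x \<theta>}
  \<le> (measure (uniform_on n K) {x \<in> space (uniform_on n K). (a + b) / 2 \<le> ip n x \<theta>})\<^sup>2"
proof -
  define H where "H s = {x \<in> space (Rn_lborel n). s \<le> ip n x \<theta>}" for s
  have [measurable]: "H s \<in> sets (Rn_lborel n)" for s unfolding H_def by measurable
  let ?m = "measure (uniform_on n K)" and ?v = "measure (Rn_lborel n) K"
  have sp: "space (uniform_on n K) = space (Rn_lborel n)" by (simp add: uniform_on_def)
  have int: "(\<integral>\<^sup>+x. indicator (K \<inter> H s) x \<partial>Rn_lborel n) = ennreal (?v * ?m (H s))" for s
    by (simp add: emeasure_Int_body)
  have "(\<integral>\<^sup>+x. indicator (K \<inter> H a) x \<partial>Rn_lborel n) * (\<integral>\<^sup>+x. indicator (K \<inter> H b) x \<partial>Rn_lborel n)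
    \<le> (\<integral>\<^sup>+x. indicator (K \<inter> H ((a + b) / 2)) x \<partial>Rn_lborel n)\<^sup>2"
  proof (rule prekopa_leindler_midpoint)
    fix x y
    have "(\<lambda>i\<in>{..<n}. (x i + y i) / 2) \<in> K \<inter> H ((a + b) / 2)" if x: "x \<in> K \<inter> H a" and y: "y \<in> K \<inter> H b"
    proof -
      have eq: "(\<lambda>i\<in>{..<n}. (x i + y i) / 2) = (\<lambda>i\<in>{..<n}. 1 / 2 * x i + 1 / 2 * y i)"
        by (auto simp: restrict_def field_simps)
      have "(\<lambda>i\<in>{..<n}. 1 / 2 * x i + 1 / 2 * y i) \<in> K" by (rule body_convexD) (use x y in auto)
      moreover have "ip n (\<lambda>i\<in>{..<n}. 1 / 2 * x i + 1 / 2 * y i) \<theta> \<ge> (a + b) / 2"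
        using x y unfolding ip_restrict_affine by (auto simp: H_def)
      ultimately show ?thesis unfolding eq by (auto simp: H_def)
    qed
    then show "indicator (K \<inter> H a) x * indicator (K \<inter> H b) y
        \<le> (indicator (K \<inter> H ((a + b) / 2)) (\<lambda>i\<in>{..<n}. (x i + y i) / 2) :: ennreal)\<^sup>2"
      by (auto simp: indicator_def)
  qed measurable
  then have "ennreal ((?v * ?m (H a)) * (?v * ?m (H b))) \<le> ennreal ((?v * ?m (H ((a + b) / 2)))\<^sup>2)"
    unfolding int by (simp add: ennreal_power[symmetric] ennreal_mult)
  then have "(?v * ?m (H a)) * (?v * ?m (H b)) \<le> (?v * ?m (H ((a + b) / 2)))\<^sup>2"
    by (simp add: ennreal_le_iff)
  then have "?v\<^sup>2 * (?m (H a) * ?m (H b)) \<le> ?v\<^sup>2 * (?m (H ((a + b) / 2)))\<^sup>2"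
    by (simp add: power2_eq_square mult_ac)
  then have "?m (H a) * ?m (H b) \<le> (?m (H ((a + b) / 2)))\<^sup>2"
    using body_measure_pos by simp
  then show ?thesis by (simp add: H_def sp)
qed

lemma body_ip_bounded: "\<exists>L. \<forall>x\<in>K. \<bar>ip n x \<theta>\<bar> \<le> L"
proof -
  have "compact ((\<lambda>x. ip n x \<theta>) ` K)"
    using image_compactin[OF _ continuous_map_ip] body by (auto simp: convex_body_def)
  then show ?thesis using compact_imp_bounded[of "(\<lambda>x. ip n x \<theta>) ` K"] by (auto simp: bounded_iff)
qed

lemma expectation_ip_eq_0:
  assumes "center_of_mass n K = Rn_origin n"
  shows "integral\<^sup>L (uniform_on n K) (\<lambda>x. ip n x \<theta>) = 0"
proof -
  interpret prob_space "uniform_on n K" by (rule prob_space_uniform_on)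
  obtain R where R: "\<And>x i. x \<in> K \<Longrightarrow> i < n \<Longrightarrow> \<bar>x i\<bar> \<le> R"
    using compactin_Rn_bounded[of n K] body by (auto simp: convex_body_def)
  have meas: "(\<lambda>x. x i) \<in> borel_measurable (uniform_on n K)" if "i < n" for i
    using measurable_coordinate_Rn[OF that] by (simp add: uniform_on_def)
  have int: "integrable (uniform_on n K) (\<lambda>x. x i)" if "i < n" for i
  proof (rule integrable_const_bound[where B = R])
    show "AE x in uniform_on n K. norm (x i) \<le> R"
      unfolding uniform_on_def using R that by (intro AE_uniform_measureI) auto
  qed (rule meas[OF that])
  have "expectation (\<lambda>x. x i) = 0" if "i < n" for i
    using fun_cong[OF assms, of i] that by (simp add: center_of_mass_def Rn_origin_def integral_uniform_on)
  then show ?thesis unfolding ip_def using int by (subst Bochner_Integration.integral_sum) auto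
qed

lemma centroid_halfspace_ge:
  assumes "center_of_mass n K = Rn_origin n"
  shows "measure (uniform_on n K) {x \<in> space (uniform_on n K). 0 \<le> ip n x \<theta>} \<ge> 1 / 6"
proof -
  interpret prob_space "uniform_on n K" by (rule prob_space_uniform_on)
  obtain L where L: "\<forall>x\<in>K. \<bar>ip n x \<theta>\<bar> \<le> L" using body_ip_bounded by auto
  show ?thesis
  proof (rule gruenbaum_log_concave)
    show "(\<lambda>x. ip n x \<theta>) \<in> borel_measurable (uniform_on n K)"
      using measurable_ip by (simp add: uniform_on_def)
    show "AE x in uniform_on n K. \<bar>ip n x \<theta>\<bar> \<le> L"
      unfolding uniform_on_def using L by (intro AE_uniform_measureI) auto
  qed (rule expectation_ip_eq_0[OF assms] uniform_on_midpoint_log_concave)+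
qed

lemma shifted_halfspace_ge:
  assumes com: "center_of_mass n K = Rn_origin n" and n: "n \<ge> 1"
    and y: "y \<in> K"
  shows "measure (uniform_on n K) {x \<in> space (uniform_on n K). ip n y \<theta> / (2 * real n) \<le> ip n x \<theta>} \<ge> 1 / 12"
proof -
  \<comment> \<open>Half of 1/n, so that Bernoulli's inequality leaves (1 - t)^n \<ge> 1 - n t =
    1/2. This is the origin of the constant \<open>c1\<close> = 2.\<close>
  define t where "t = 1 / (2 * real n)"
  have t: "0 < t" "t \<le> 1 / 2" "real n * t = 1 / 2" using n by (auto simp: t_def field_simps)
  define H where "H s = {x \<in> space (Rn_lborel n). s \<le> ip n x \<theta>}" for s
  have [measurable]: "H s \<in> sets (Rn_lborel n)" for s unfolding H_def by measurable
  let ?m = "measure (uniform_on n K)" and ?v = "measure (Rn_lborel n) K"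
  have sp: "space (uniform_on n K) = space (Rn_lborel n)" by (simp add: uniform_on_def)
  have "ennreal ((1 - t) ^ n) * emeasure (Rn_lborel n) (K \<inter> H 0)
      \<le> emeasure (Rn_lborel n) (K \<inter> H (t * ip n y \<theta>))"
  proof (rule emeasure_Rn_affine_le[where t = "\<lambda>i. t * y i"])
    fix x assume x: "x \<in> K \<inter> H 0"
    have "(\<lambda>i\<in>{..<n}. t * y i + (1 - t) * x i) \<in> K"
      by (rule body_convexD) (use x y t in auto)
    moreover have "ip n (\<lambda>i\<in>{..<n}. t * y i + (1 - t) * x i) \<theta> \<ge> t * ip n y \<theta>"
      unfolding ip_restrict_affine using x t by (auto simp: H_def)
    ultimately show "(\<lambda>i\<in>{..<n}. t * y i + (1 - t) * x i) \<in> K \<inter> H (t * ip n y \<theta>)"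
      by (auto simp: H_def)
  qed (use t in auto)
  then have "ennreal ((1 - t) ^ n * (?v * ?m (H 0))) \<le> ennreal (?v * ?m (H (t * ip n y \<theta>)))"
    using t by (simp add: emeasure_Int_body ennreal_mult)
  then have "?v * ((1 - t) ^ n * ?m (H 0)) \<le> ?v * ?m (H (t * ip n y \<theta>))"
    by (simp add: ennreal_le_iff mult_ac)
  then have "(1 - t) ^ n * ?m (H 0) \<le> ?m (H (t * ip n y \<theta>))"
    using body_measure_pos by simp
  moreover have "1 / 2 \<le> (1 - t) ^ n"
    using Bernoulli_inequality[of "- t" n] t by simp
  moreover have "1 / 6 \<le> ?m (H 0)" using centroid_halfspace_ge[OF com] by (simp add: H_def sp)
  ultimately have "1 / 2 * (1 / 6) \<le> ?m (H (t * ip n y \<theta>))"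
    using mult_mono[of "1 / 2" "(1 - t) ^ n" "1 / 6" "?m (H 0)"] by simp
  then show ?thesis by (simp add: H_def sp t_def)
qed

end

section \<open>Separation from the convex hull\<close>

lemma Rn_convexD:
  "Rn_convex n T \<Longrightarrow> x \<in> T \<Longrightarrow> y \<in> T \<Longrightarrow> 0 \<le> u \<Longrightarrow> 0 \<le> v \<Longrightarrow> u + v = 1 \<Longrightarrow>
    (\<lambda>i\<in>{..<n}. u * x i + v * y i) \<in> T"
  unfolding Rn_convex_def by blast

text \<open>The last point is split off and the other weights are renormalized by their sum
  \<open>s\<close>; for s = 0 all weight sits on the last point.\<close>

lemma Rn_convex_sum:
  fixes x :: "nat \<Rightarrow> point"
  assumes T: "Rn_convex n T"
  shows "(\<And>i. i < m \<Longrightarrow> x i \<in> T) \<Longrightarrow> (\<And>i. i < m \<Longrightarrow> 0 \<le> w i) \<Longrightarrow> (\<Sum>i<m. w i) = 1 \<Longrightarrow>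
    (\<lambda>j\<in>{..<n}. \<Sum>i<m. w i * x i j) \<in> T"
proof (induction m arbitrary: w)
  case (Suc m)
  define s where "s = (\<Sum>i<m. w i)"
  have ws: "w m = 1 - s" "0 \<le> s" "0 \<le> w m" using Suc.prems by (auto simp: s_def intro: sum_nonneg)
  have ext: "(\<lambda>j\<in>{..<n}. x m j) = x m"
    using T Suc.prems(1)[of m] by (auto simp: Rn_convex_def PiE_restrict)
  show ?case
  proof (cases "s = 0")
    case True
    have "\<forall>i\<in>{..<m}. w i = 0"
      using True Suc.prems(2) unfolding s_def by (subst (asm) sum_nonneg_eq_0_iff) auto
    then have "(\<lambda>j\<in>{..<n}. \<Sum>i<Suc m. w i * x i j) = (\<lambda>j\<in>{..<n}. x m j)"
      using True ws by (auto simp: restrict_def)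
    then show ?thesis using ext Suc.prems(1)[of m] by simp
  next
    case False
    let ?z = "\<lambda>j\<in>{..<n}. \<Sum>i<m. w i / s * x i j"
    have z: "?z \<in> T"
      using Suc.prems False ws by (intro Suc.IH) (auto simp: s_def simp flip: sum_divide_distrib)
    have "(\<lambda>j\<in>{..<n}. s * ?z j + w m * x m j) \<in> T"
      using ws Suc.prems(1)[of m] by (intro Rn_convexD[OF T z]) auto
    also have "(\<lambda>j\<in>{..<n}. s * ?z j + w m * x m j) = (\<lambda>j\<in>{..<n}. \<Sum>i<Suc m. w i * x i j)"
      using False by (auto simp: restrict_def sum_distrib_left)
    finally show ?thesis .
  qed
qed simp

section \<open>Nearest points of the hull and separation\<close>

text \<open>Pinning the weights from \<open>N\<close> on to 0 makes this a closed subset of a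
  product of compact sets, hence compact in the full function space. Minimizing over weights gives a
  nearest point without showing that the hull is closed.\<close>

definition simplex_weights :: "nat \<Rightarrow> (nat \<Rightarrow> real) set" where
  "simplex_weights N = {w. (\<forall>i. w i \<in> (if i < N then {0..1} else {0})) \<and> (\<Sum>i<N. w i) = 1}"

lemma compact_simplex_weights: "compact (simplex_weights N)"
proof -
  let ?B = "\<Pi>\<^sub>E i\<in>UNIV. if i < N then {0..1} else {0::real}"
  have "compactin (product_topology (\<lambda>_::nat. euclideanreal) UNIV) ?B"
    by (subst compactin_PiE) auto
  then have "compact ?B" by (simp add: euclidean_product_topology)
  moreover have "closed {w :: nat \<Rightarrow> real. (\<Sum>i<N. w i) = 1}"
    by (intro closed_Collect_eq continuous_intros continuous_on_coordinatewise_then_product) auto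
  moreover have "simplex_weights N = ?B \<inter> {w. (\<Sum>i<N. w i) = 1}"
    by (auto simp: simplex_weights_def PiE_def Pi_def)
  ultimately show ?thesis by (simp add: compact_Int_closed)
qed

text \<open>First-order optimality: divide by \<open>s\<close> and let it tend to 0. It is applied
  to the squared distance along a segment that starts at its minimizer.\<close>

lemma nonpos_if_quadratic_nonneg:
  fixes a b :: real
  assumes "\<And>s. 0 < s \<Longrightarrow> s \<le> 1 \<Longrightarrow> 2 * s * a \<le> s\<^sup>2 * b"
  shows "a \<le> 0"
proof (rule ccontr)
  assume a: "\<not> a \<le> 0"
  define s where "s = min 1 (a / (\<bar>b\<bar> + 1))"
  have s: "0 < s" "s \<le> 1" using a by (auto simp: s_def)
  have "s \<le> a / (\<bar>b\<bar> + 1)" by (simp add: s_def)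
  then have "s * (\<bar>b\<bar> + 1) \<le> a" by (simp add: pos_le_divide_eq)
  moreover have "s * b \<le> s * (\<bar>b\<bar> + 1)" using s by (intro mult_left_mono) auto
  moreover have "s * (2 * a) \<le> s * (s * b)" using assms[OF s] by (simp add: power2_eq_square mult_ac)
  then have "2 * a \<le> s * b" using s by simp
  ultimately show False using a by linarith
qed

text \<open>The separating direction is \<open>w - z\<close>, with \<open>z\<close> the point of the hull nearest to \<open>w\<close>.\<close>

lemma exists_separating_direction:
  fixes x :: "nat \<Rightarrow> point"
  assumes N: "N > 0" and x: "\<And>i. i < N \<Longrightarrow> x i \<in> {..<n} \<rightarrow>\<^sub>E UNIV"
    and w: "w \<in> {..<n} \<rightarrow>\<^sub>E UNIV" "w \<notin> Rn_convex n hull (x ` {..<N})"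
  shows "\<exists>\<theta>. \<forall>i<N. ip n (x i) \<theta> < ip n w \<theta>"
proof -
  define comb where "comb \<mu> j = (\<Sum>i<N. \<mu> i * x i j)" for \<mu> :: "nat \<Rightarrow> real" and j
  define q where "q \<mu> = (\<Sum>j<n. (w j - comb \<mu> j)\<^sup>2)" for \<mu>
  have "continuous_on (simplex_weights N) q"
    unfolding q_def comb_def
    by (intro continuous_intros continuous_on_subset[OF continuous_on_product_coordinates]) auto
  moreover have "(\<lambda>i. if i = 0 then 1 else 0) \<in> simplex_weights N"
    using N by (auto simp: simplex_weights_def)
  ultimately obtain \<mu> where \<mu>: "\<mu> \<in> simplex_weights N" "\<And>\<nu>. \<nu> \<in> simplex_weights N \<Longrightarrow> q \<mu> \<le> q \<nu>"
    using continuous_attains_inf[OF compact_simplex_weights] by blast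
  define \<theta> where "\<theta> j = w j - comb \<mu> j" for j
  have \<mu>0: "0 \<le> \<mu> i" "\<mu> i \<le> 1" if "i < N" for i
    using \<mu>(1) that by (auto simp: simplex_weights_def dest!: spec[of _ i])
  have \<mu>1: "(\<Sum>i<N. \<mu> i) = 1" and \<mu>N: "\<And>i. \<not> i < N \<Longrightarrow> \<mu> i = 0"
    using \<mu>(1) by (auto simp: simplex_weights_def split: if_splits)
  have "ip n \<theta> \<theta> > 0"
  proof (rule ccontr)
    assume "\<not> ?thesis"
    then have "(\<Sum>j<n. \<theta> j * \<theta> j) = 0"
      unfolding ip_def by (meson antisym_conv2 not_less sum_nonneg zero_le_square)
    then have "\<forall>j\<in>{..<n}. \<theta> j * \<theta> j = 0" by (subst (asm) sum_nonneg_eq_0_iff) auto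
    then have "w j = comb \<mu> j" if "j < n" for j using that by (simp add: \<theta>_def)
    then have "w = (\<lambda>j\<in>{..<n}. comb \<mu> j)" using w(1)
      by (auto simp: PiE_def extensional_def restrict_def)
    \<comment> \<open>The hull is an intersection of convex supersets, so the combination is placed
      in each of them; distance 0 would therefore put \<open>w\<close> into the hull.\<close>
    moreover have "(\<lambda>j\<in>{..<n}. comb \<mu> j) \<in> T" if "Rn_convex n T" "x ` {..<N} \<subseteq> T" for T
      unfolding comb_def using that \<mu>0 \<mu>1 by (intro Rn_convex_sum) auto
    ultimately show False using w(2) by (auto simp: hull_def)
  qed
  moreover have "ip n (x i) \<theta> \<le> ip n (comb \<mu>) \<theta>" if i: "i < N" for i
  proof -
    define v where "v j = x i j - comb \<mu> j" for j
    have "ip n \<theta> v \<le> 0"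
    proof (rule nonpos_if_quadratic_nonneg)
      fix s :: real assume s: "0 < s" "s \<le> 1"
      \<comment> \<open>Moves the fraction \<open>s\<close> of the mass to vertex \<open>i\<close>,
        that is, goes from the nearest point towards \<open>x i\<close>.\<close>
      define \<nu> where "\<nu> k = (1 - s) * \<mu> k + s * (if k = i then 1 else 0)" for k
      have sum\<nu>: "(\<Sum>k<N. \<nu> k * c k) = (1 - s) * (\<Sum>k<N. \<mu> k * c k) + s * c i" for c :: "nat \<Rightarrow> real"
      proof -
        have "(\<Sum>k<N. \<nu> k * c k) = (\<Sum>k<N. (1 - s) * (\<mu> k * c k) + (if k = i then s * c i else 0))"
          by (intro sum.cong) (auto simp: \<nu>_def algebra_simps)
        also have "\<dots> = (1 - s) * (\<Sum>k<N. \<mu> k * c k) + s * c i"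
          using i by (simp add: sum.distrib sum_distrib_left)
        finally show ?thesis .
      qed
      have "\<nu> \<in> simplex_weights N"
      proof -
        have nn: "0 \<le> \<nu> k" if "k < N" for k
          using \<mu>0[OF that] s by (auto simp: \<nu>_def intro!: add_nonneg_nonneg mult_nonneg_nonneg)
        have one: "(\<Sum>k<N. \<nu> k) = 1" using sum\<nu>[of "\<lambda>_. 1"] \<mu>1 by simp
        moreover have "\<nu> k \<le> 1" if "k < N" for k
          using member_le_sum[of k "{..<N}" \<nu>] nn one that by auto
        moreover have "\<nu> k = 0" if "\<not> k < N" for k using that i \<mu>N by (auto simp: \<nu>_def)
        ultimately show ?thesis using nn by (auto simp: simplex_weights_def)
      qed
      then have "q \<mu> \<le> q \<nu>" by (rule \<mu>(2))
      also have "q \<nu> = (\<Sum>j<n. (\<theta> j - s * v j)\<^sup>2)"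
        unfolding q_def comb_def[of \<nu>] sum\<nu>
        by (intro sum.cong) (auto simp: \<theta>_def v_def comb_def algebra_simps)
      also have "\<dots> = q \<mu> - 2 * s * ip n \<theta> v + s\<^sup>2 * ip n v v"
        unfolding q_def \<theta>_def[symmetric] ip_def
        by (simp add: power2_eq_square algebra_simps sum.distrib sum_subtractf sum_distrib_left)
      finally show "2 * s * ip n \<theta> v \<le> s\<^sup>2 * ip n v v" by simp
    qed
    then show ?thesis by (simp add: ip_def v_def algebra_simps sum_subtractf)
  qed
  moreover have "ip n w \<theta> = ip n (comb \<mu>) \<theta> + ip n \<theta> \<theta>"
    unfolding ip_def sum.distrib[symmetric] by (intro sum.cong) (auto simp: \<theta>_def algebra_simps)
  ultimately show ?thesis by (intro exI[of _ \<theta>]) (metis add.commute add_strict_increasing)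
qed

text \<open>Finitely many strict inequalities, continuous in the direction, survive a small
  perturbation of \<theta> to a rational one.\<close>

lemma exists_rational_separating_direction:
  fixes x :: "nat \<Rightarrow> point"
  assumes "\<And>i. i < N \<Longrightarrow> ip n (x i) \<theta> < ip n w \<theta>"
  shows "\<exists>\<eta>\<in>{..<n} \<rightarrow>\<^sub>E \<rat>. \<forall>i<N. ip n (x i) \<eta> < ip n w \<eta>"
proof -
  have "\<exists>r\<in>\<rat>. \<theta> j < r \<and> r < \<theta> j + inverse (real (Suc k))" for j k
    using Rats_dense_in_real[of "\<theta> j" "\<theta> j + inverse (real (Suc k))"] by auto
  then have "\<exists>r. \<forall>k j. r k j \<in> \<rat> \<and> \<theta> j < r k j \<and> r k j < \<theta> j + inverse (real (Suc k))"
    by (intro choice allI) blast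
  then obtain r where r: "\<And>j k. r k j \<in> \<rat>" "\<And>j k. \<theta> j < r k j" "\<And>j k. r k j < \<theta> j + inverse (real (Suc k))"
    by blast
  have lim: "(\<lambda>k. r k j) \<longlonglongrightarrow> \<theta> j" for j
  proof (rule real_tendsto_sandwich[of "\<lambda>_. \<theta> j" _ _ "\<lambda>k. \<theta> j + inverse (real (Suc k))"])
    show "(\<lambda>k. \<theta> j + inverse (real (Suc k))) \<longlonglongrightarrow> \<theta> j"
      using tendsto_add[OF tendsto_const LIMSEQ_inverse_real_of_nat, of "\<theta> j"] by simp
  qed (use r in \<open>auto intro!: always_eventually less_imp_le\<close>)
  have "eventually (\<lambda>k. ip n (x i) (r k) < ip n w (r k)) sequentially" if "i \<in> {..<N}" for i
  proof -
    have "(\<lambda>k. ip n w (r k) - ip n (x i) (r k)) \<longlonglongrightarrow> ip n w \<theta> - ip n (x i) \<theta>"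
      unfolding ip_def by (intro tendsto_intros lim)
    then have "eventually (\<lambda>k. 0 < ip n w (r k) - ip n (x i) (r k)) sequentially"
      using assms that by (intro order_tendstoD) auto
    then show ?thesis by simp
  qed
  then have "eventually (\<lambda>k. \<forall>i\<in>{..<N}. ip n (x i) (r k) < ip n w (r k)) sequentially"
    by (intro eventually_ball_finite) auto
  then obtain k where k: "\<And>i. i < N \<Longrightarrow> ip n (x i) (r k) < ip n w (r k)"
    using eventually_happens'[OF sequentially_bot] by fastforce
  have "ip n v (restrict (r k) {..<n}) = ip n v (r k)" for v by (simp add: ip_def)
  then show ?thesis using k r(1) by (intro bexI[of _ "restrict (r k) {..<n}"]) auto
qed

text \<open>\<open>ip n (Y \<theta>) \<theta>\<close> is the support function of \<open>K\<close>.
  An equivalence, and not only the implication from hitting to containment, identifies the event of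
  the theorem with a countable and hence measurable condition.\<close>

lemma subset_scaled_hull_iff:
  fixes x :: "nat \<Rightarrow> point"
  assumes K: "K \<subseteq> {..<n} \<rightarrow>\<^sub>E UNIV" and Y: "\<And>\<theta>. Y \<theta> \<in> K" "\<And>\<theta> y. y \<in> K \<Longrightarrow> ip n y \<theta> \<le> ip n (Y \<theta>) \<theta>"
    and N: "N > 0" and x: "\<And>i. i < N \<Longrightarrow> x i \<in> {..<n} \<rightarrow>\<^sub>E UNIV" and c: "c > 0"
  shows "K \<subseteq> Rn_scale n c (Rn_convex n hull (x ` {..<N})) \<longleftrightarrow>
    (\<forall>\<theta>\<in>{..<n} \<rightarrow>\<^sub>E \<rat>. \<exists>i<N. ip n (Y \<theta>) \<theta> / c \<le> ip n (x i) \<theta>)"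
proof
  assume sub: "K \<subseteq> Rn_scale n c (Rn_convex n hull (x ` {..<N}))"
  show "\<forall>\<theta>\<in>{..<n} \<rightarrow>\<^sub>E \<rat>. \<exists>i<N. ip n (Y \<theta>) \<theta> / c \<le> ip n (x i) \<theta>"
  proof (rule ballI, rule ccontr)
    fix \<theta> assume neg: "\<not> (\<exists>i<N. ip n (Y \<theta>) \<theta> / c \<le> ip n (x i) \<theta>)"
    obtain w where w: "w \<in> Rn_convex n hull (x ` {..<N})" "Y \<theta> = (\<lambda>i\<in>{..<n}. c * w i)"
      using sub Y(1)[of \<theta>] unfolding Rn_scale_def by blast
    define b where "b = ip n (Y \<theta>) \<theta> / c"
    \<comment> \<open>The open halfspace is convex and holds all sample points, hence the hull; but
      \<open>w\<close>, the rescaled maximizer, lies on its boundary.\<close>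
    let ?T = "{v \<in> {..<n} \<rightarrow>\<^sub>E UNIV. ip n v \<theta> < b}"
    have "Rn_convex n ?T" unfolding Rn_convex_def
    proof (intro conjI ballI allI impI)
      fix v v' and s t :: real
      assume *: "v \<in> ?T" "v' \<in> ?T" "0 \<le> s" "0 \<le> t" "s + t = 1"
      have "s * ip n v \<theta> + t * ip n v' \<theta> < b"
        using * by (intro convex_bound_lt) auto
      then show "(\<lambda>i\<in>{..<n}. s * v i + t * v' i) \<in> ?T" by (simp add: ip_restrict_affine)
    qed auto
    moreover have "x ` {..<N} \<subseteq> ?T" using x neg by (auto simp: b_def not_le)
    ultimately have "w \<in> ?T" using w(1) hull_minimal[of "x ` {..<N}" ?T "Rn_convex n"] by blast
    moreover have "ip n (Y \<theta>) \<theta> = c * ip n w \<theta>"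
      unfolding w(2) by (simp add: ip_def sum_distrib_left mult.assoc)
    ultimately show False using c by (simp add: b_def)
  qed
next
  assume R: "\<forall>\<theta>\<in>{..<n} \<rightarrow>\<^sub>E \<rat>. \<exists>i<N. ip n (Y \<theta>) \<theta> / c \<le> ip n (x i) \<theta>"
  show "K \<subseteq> Rn_scale n c (Rn_convex n hull (x ` {..<N}))"
  proof
    fix y assume y: "y \<in> K"
    define w where "w = (\<lambda>i\<in>{..<n}. y i / c)"
    have "w \<in> Rn_convex n hull (x ` {..<N})"
    proof (rule ccontr)
      assume "w \<notin> Rn_convex n hull (x ` {..<N})"
      moreover have "w \<in> {..<n} \<rightarrow>\<^sub>E UNIV" by (simp add: w_def)
      ultimately have "\<exists>\<theta>. \<forall>i<N. ip n (x i) \<theta> < ip n w \<theta>"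
        using N x by (intro exists_separating_direction)
      then obtain \<theta> where "\<And>i. i < N \<Longrightarrow> ip n (x i) \<theta> < ip n w \<theta>" by blast
      then obtain \<eta> where \<eta>: "\<eta> \<in> {..<n} \<rightarrow>\<^sub>E \<rat>" "\<forall>i<N. ip n (x i) \<eta> < ip n w \<eta>"
        using exists_rational_separating_direction[where x = x and \<theta> = \<theta> and w = w and N = N and n = n] by blast
      have "ip n w \<eta> = ip n y \<eta> / c" by (simp add: ip_def w_def sum_divide_distrib)
      also have "\<dots> \<le> ip n (Y \<eta>) \<eta> / c" using Y(2)[OF y] c by (intro divide_right_mono) auto
      finally have "\<forall>i<N. ip n (x i) \<eta> < ip n (Y \<eta>) \<eta> / c" using \<eta>(2) by force
      then show False using R \<eta>(1) by force
    qed
    moreover have "y = (\<lambda>i\<in>{..<n}. c * w i)"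
      using c K y by (auto simp: w_def PiE_def extensional_def restrict_def fun_eq_iff)
    ultimately show "y \<in> Rn_scale n c (Rn_convex n hull (x ` {..<N}))"
      unfolding Rn_scale_def by blast
  qed
qed

section \<open>The random polytope\<close>

text \<open>Here 24 is 2 / \<epsilon> for \<epsilon> = 1/12. With x = 1/200 the growth per dimension
  is 200 (201/200)^1920, at most 200 (128/100)^40 since 1920 = 48 * 40, against a decay of
  2^40.\<close>

lemma growth_times_decay_less:
  assumes "n \<ge> 1"
  shows "24 * (\<Sum>i\<le>n + 1. real ((2 * (960 * n)) choose i)) / 2 ^ (40 * n) < exp (- real n)"
proof -
  \<comment> \<open>The ratio of growth to decay per dimension. The extra factor 200 from the
    exponent n + 1 joins 24 to form 4800.\<close>
  define q :: real where "q = 200 * (64 / 100) ^ 40"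
  have q: "0 \<le> q" "4800 * q < 1 / 3" unfolding q_def by (simp_all add: power_divide)
  have "(\<Sum>i\<le>n + 1. real ((2 * (960 * n)) choose i)) \<le> (1 / (1 / 200)) ^ (n + 1) * (1 + 1 / 200) ^ (2 * (960 * n))"
    by (rule sum_binomial_le) auto
  also have "\<dots> = 200 * 200 ^ n * (((201 / 200) ^ 48) ^ 40) ^ n"
    by (simp flip: power_mult)
  also have "\<dots> \<le> 200 * 200 ^ n * ((128 / 100) ^ 40) ^ n"
  proof -
    have "(201 / 200 :: real) ^ 48 \<le> 128 / 100" by (simp add: power_divide)
    then show ?thesis by (intro mult_left_mono power_mono) auto
  qed
  finally have "24 * (\<Sum>i\<le>n + 1. real ((2 * (960 * n)) choose i)) / 2 ^ (40 * n)
      \<le> 24 * (200 * 200 ^ n * ((128 / 100) ^ 40) ^ n) / 2 ^ (40 * n)"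
    by (intro divide_right_mono mult_left_mono) auto
  also have "\<dots> = 4800 * q ^ n"
  proof -
    have "24 * (200 * 200 ^ n * a ^ n) / b ^ n = 4800 * (200 * (a / b)) ^ n" for a b :: real
      by (simp add: power_mult_distrib power_divide)
    moreover have "(128 / 100) ^ 40 / 2 ^ 40 = (64 / 100 :: real) ^ 40"
      unfolding power_divide[symmetric] by simp
    ultimately show ?thesis unfolding q_def by (simp only: power_mult)
  qed
  \<comment> \<open>The prefactor is absorbed into the power, since n \<ge> 1; there is ample room
    below exp (-1).\<close>
  also have "\<dots> \<le> 4800 ^ n * q ^ n"
    using q(1) assms by (intro mult_right_mono self_le_power zero_le_power) auto
  also have "\<dots> = (4800 * q) ^ n" by (simp only: power_mult_distrib)
  also have "\<dots> < exp (- 1) ^ n"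
  proof (rule power_strict_mono)
    have "1 / 3 \<le> exp (- 1 :: real)" using exp_le by (simp add: exp_minus field_simps)
    then show "4800 * q < exp (- 1)" using q(2) by linarith
  qed (use q assms in auto)
  also have "\<dots> = exp (- real n)" by (simp flip: exp_of_nat_mult)
  finally show ?thesis .
qed

theorem theorem1p1:
  shows "\<exists>\<alpha> c1 :: real. \<alpha> > 1 \<and> c1 > 0 \<and>
    (\<forall>n\<ge>1. \<forall>K. convex_body n K \<and> center_of_mass n K = Rn_origin n \<longrightarrow>
      (\<forall>N. N = nat \<lceil>\<alpha> * real n\<rceil> \<longrightarrow>
        measure (iid_uniform n K N)
          {x \<in> space (iid_uniform n K N).
             K \<subseteq> Rn_scale n (c1 * real n) (Rn_convex n hull (x ` {..<N}))}
        > 1 - exp (- real n)))"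
\<comment> \<open>960 / 12 = 80 = 2 * 40, so the condition
  \<open>2 * real k \<le> \<epsilon> * N\<close> holds with equality for \<open>k\<close> =
  40n.\<close>
proof (rule exI[of _ 960], rule exI[of _ 2], intro conjI allI impI)
  fix n :: nat and K N
  assume n: "1 \<le> n" and K: "convex_body n K \<and> center_of_mass n K = Rn_origin n"
    and N: "N = nat \<lceil>960 * real n\<rceil>"
  have body: "convex_body n K" and com: "center_of_mass n K = Rn_origin n" using K by auto
  have N960: "N = 960 * n"
  proof -
    have "960 * real n = real (960 * n)" by simp
    then show ?thesis unfolding N by (simp only: ceiling_of_nat nat_int)
  qed
  define U where "U = uniform_on n K"
  interpret U: prob_space U unfolding U_def using body by (rule prob_space_uniform_on)
  have spU: "space U = {..<n} \<rightarrow>\<^sub>E UNIV" by (simp add: U_def uniform_on_def)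
  have "\<exists>y\<in>K. \<forall>x\<in>K. ip n x \<theta> \<le> ip n y \<theta>" for \<theta>
    using compactin_Rn_attains_max body_nonempty[OF body] body by (auto simp: convex_body_def)
  then obtain Y where Y: "\<And>\<theta>. Y \<theta> \<in> K" "\<And>\<theta> x. x \<in> K \<Longrightarrow> ip n x \<theta> \<le> ip n (Y \<theta>) \<theta>"
    by metis
  define t where "t \<theta> = ip n (Y \<theta>) \<theta> / (2 * real n)" for \<theta>
  define \<Theta> where "\<Theta> = ({..<n} \<rightarrow>\<^sub>E \<rat> :: point set)"
  define H where "H \<theta> = {x \<in> space U. t \<theta> \<le> ip n x \<theta>}" for \<theta>
  define G where "G = (\<Sum>i\<le>n + 1. (2 * N) choose i)"
  interpret ghost_sample U "H ` \<Theta>" N "40 * n" G "1 / 12"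
  proof
    show "countable (H ` \<Theta>)"
      unfolding \<Theta>_def by (intro countable_image countable_PiE) (auto intro: countable_rat)
    show "A \<in> sets U" if "A \<in> H ` \<Theta>" for A
    proof -
      have "(\<lambda>x. ip n x \<theta>) \<in> borel_measurable U" for \<theta>
        unfolding U_def uniform_on_def using measurable_ip by simp
      then show ?thesis using that by (auto simp: H_def)
    qed
    show "1 / 12 \<le> measure U A" if "A \<in> H ` \<Theta>" for A
      using that shifted_halfspace_ge[OF body com n Y(1)] by (auto simp: H_def t_def U_def)
    show "card ((\<lambda>A. {i\<in>{..<2 * N}. z i \<in> A}) ` H ` \<Theta>) \<le> G"
      if z: "z \<in> space (\<Pi>\<^sub>M i\<in>{..<2 * N}. U)" for z
    proof -
      have "(\<lambda>A. {i\<in>{..<2 * N}. z i \<in> A}) ` H ` \<Theta> = (\<lambda>\<theta>. {i\<in>{..<2 * N}. t \<theta> \<le> ip n (z i) \<theta>}) ` \<Theta>"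
        using z unfolding image_image by (intro image_cong) (auto simp: H_def space_PiM PiE_def Pi_def)
      then show ?thesis using card_halfspace_traces_le[of "2 * N" t n z \<Theta>] by (simp add: G_def)
    qed
  qed (use n in \<open>auto simp: N960\<close>)
  interpret P1: prob_space P1 by (intro prob_space_PiM) (rule U.prob_space_axioms)
  have iid: "iid_uniform n K N = P1" by (simp add: iid_uniform_def U_def)
  \<comment> \<open>An exact identity of sets, so the event inherits measurability from
    \<open>missed\<close> and its probability is that of a complement.\<close>
  have "{x \<in> space P1. K \<subseteq> Rn_scale n (2 * real n) (Rn_convex n hull (x ` {..<N}))} = space P1 - missed"
  proof -
    have "K \<subseteq> Rn_scale n (2 * real n) (Rn_convex n hull (x ` {..<N})) \<longleftrightarrow> x \<notin> missed"
      if x: "x \<in> space P1" for x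
    proof -
      have xi: "x i \<in> {..<n} \<rightarrow>\<^sub>E UNIV" if "i < N" for i
        using x that spU by (auto simp: space_PiM PiE_def Pi_def)
      have "K \<subseteq> Rn_scale n (2 * real n) (Rn_convex n hull (x ` {..<N})) \<longleftrightarrow>
          (\<forall>\<theta>\<in>{..<n} \<rightarrow>\<^sub>E \<rat>. \<exists>i<N. ip n (Y \<theta>) \<theta> / (2 * real n) \<le> ip n (x i) \<theta>)"
        using n by (intro subset_scaled_hull_iff body_subset[OF body] Y xi) (auto simp: N960)
      also have "\<dots> \<longleftrightarrow> (\<forall>\<theta>\<in>\<Theta>. \<exists>i<N. x i \<in> H \<theta>)"
      proof -
        have "x i \<in> H \<theta> \<longleftrightarrow> ip n (Y \<theta>) \<theta> / (2 * real n) \<le> ip n (x i) \<theta>" if "i < N" for i \<theta>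
          using xi[OF that] by (simp add: H_def t_def spU)
        then show ?thesis unfolding \<Theta>_def by (intro ball_cong refl) auto
      qed
      also have "\<dots> \<longleftrightarrow> x \<notin> missed" using x by (auto simp: missed_def)
      finally show ?thesis .
    qed
    then show ?thesis by auto
  qed
  then have "measure (iid_uniform n K N) {x \<in> space (iid_uniform n K N).
      K \<subseteq> Rn_scale n (2 * real n) (Rn_convex n hull (x ` {..<N}))} = 1 - measure P1 missed"
    unfolding iid by (simp add: P1.prob_compl)
  moreover have "measure P1 missed < exp (- real n)"
  proof -
    have "measure P1 missed \<le> 24 * real G / 2 ^ (40 * n)" using prob_missed_le by simp
    also have "\<dots> < exp (- real n)"
      using growth_times_decay_less[OF n] by (simp add: G_def N960)
    finally show ?thesis .
  qed
  ultimately show "1 - exp (- real n) < measure (iid_uniform n K N) {x \<in> space (iid_uniform n K N).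
      K \<subseteq> Rn_scale n (2 * real n) (Rn_convex n hull (x ` {..<N}))}"
    by simp
qed auto

end
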